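(* Consider the multi-area interchange scheduling setting described in the context, and assume: (i) for every area $n$, every $q$ with $q\le Q$ and every realization $d_n$ of the net load, the second-stage problem $P_n(q_n,d_n)$ is feasible and is neither primal nor dual degenerate, and $\bar C(q)$ is finite for all $q\le Q$; (ii) for each area $n$, the net loads $\{d_n^t\}_{t\ge1}$ are independent and identically distributed with common distribution $\mathscr{F}_n$; (iii) every one-dimensional minimization in the update rule below has a minimizer (if there are several, any one is chosen). Let $q^0\in\mathbb{R}^I$ with $q^0\le Q$, and generate $\{q^t\}_{t\ge0}$ by asynchronous interface-by-interface scheduling: at time $t=1,2,\dots$, let $i_t=((t-1)\bmod I)+1$, set $q^t(j)=q^{t-1}(j)$ for $j\ne i_t$, and $$q^t(i_t)\in\arg\min_{x\le Q(i_t)}\sum_{n=1}^N\mathbb{E}_{d_n^t}\Big[C_n\big(g_n^*(\,(x,q^{t-1}(-i_t))_n\,,d_n^t)\big)\Big],$$ where $(x,q^{t-1}(-i_t))$ denotes the vector $q^{t-1}$ with its $i_t$-th entry replaced by $x$, and $(\cdot)_n$ denotes its restriction to area $n$ as defined in the context. Then every limit point $\tilde q$ of $\{q^t\}_{t\ge0}$ is an optimal solution of the first-stage problem $\min_{q\le Q}\bar C(q)$.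
   Context: There are $N$ independently operated areas and $I$ scheduling interfaces. Each interface $i\in\{1,\dots,I\}$ connects two distinct areas and carries a scalar flow $q(i)$ in a predetermined direction (from its origin area to its destination area); $q=(q(1),\dots,q(I))\in\mathbb{R}^I$ is the interchange vector and $Q\in\mathbb{R}^I$ the vector of interface capacities; $q\le Q$ is componentwise; $q(-i)$ denotes $q$ with its $i$-th entry removed. For area $n$, $q_n$ is the vector of flows on the interfaces incident to area $n$, taken in the outbound direction: its entry for interface $i$ equals $q(i)$ if $n$ is the origin of interface $i$ and $-q(i)$ if $n$ is its destination. Area $n$ has a generation vector $g_n$, a random net load vector $d_n$ with distribution $\mathscr{F}_n$, a cost $C_n(g_n)=\tfrac12 g_n^\intercal H_n g_n+l_n^\intercal g_n$ with $H_n$ positive definite, a polyhedral set of generation constraints $\mathscr{G}_n$, a matrix $A_n$ of shift factors of internal buses to lines, a matrix $B_n$ of shift factors of the proxy buses to lines, and a vector $F_n$ of line capacities. The second-stage problem $P_n(q_n,d_n)$ is $$\min_{g_n\in\mathscr{G}_n} C_n(g_n)\ \text{ s.t. }\ \mathbf 1^\intercal(d_n-g_n)+\mathbf 1^\intercal q_n=0,\quad A_n(d_n-g_n)+B_nq_n\le F_n,$$ with optimal solution $g_n^*(q_n,d_n)$. The expected overall cost is $\bar C(q)=\sum_{n=1}^N\mathbb{E}_{d_n\sim\mathscr{F}_n}\big[C_n(g_n^*(q_n,d_n))\big]$, and the first-stage problem is $\min_{q\le Q}\bar C(q)$. *)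

theory Defs
  imports "HOL-Probability.Probability"
begin

text \<open>Data of one area n. Internal buses are indexed by k < nbus, lines by m < nline,
  the rows of the polyhedral generation constraint set by r < ncon.
  Vectors are functions nat => real; only the entries in the index range matter.
  Interfaces are indexed by 1..I; the columns of Bm are indexed by interface numbers
  (only columns of interfaces incident to the area are ever used).\<close>

record area_data =
  nbus  :: nat
  nline :: nat
  ncon  :: nat
  Hm    :: "nat \<Rightarrow> nat \<Rightarrow> real"
  lv    :: "nat \<Rightarrow> real"
  Gc    :: "nat \<Rightarrow> nat \<Rightarrow> real"   \<comment> \<open>G_n = {g. Gc g <= gb}\<close>
  gb    :: "nat \<Rightarrow> real"
  Am    :: "nat \<Rightarrow> nat \<Rightarrow> real"   \<comment> \<open>A_n (line m, bus k)\<close>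
  Bm    :: "nat \<Rightarrow> nat \<Rightarrow> real"   \<comment> \<open>B_n (line m, interface i)\<close>
  Fv    :: "nat \<Rightarrow> real"

text \<open>q_n: flows on interfaces incident to area n in outbound direction
  (zero on non-incident interfaces).\<close>
definition qloc :: "nat \<Rightarrow> (nat \<Rightarrow> nat) \<Rightarrow> (nat \<Rightarrow> nat) \<Rightarrow> (nat \<Rightarrow> real) \<Rightarrow> nat \<Rightarrow> (nat \<Rightarrow> real)" where
  "qloc I orig dest q n = (\<lambda>i. if i \<in> {1..I} \<and> orig i = n then q i
                               else if i \<in> {1..I} \<and> dest i = n then - q i else 0)"

definition gcost :: "area_data \<Rightarrow> (nat \<Rightarrow> real) \<Rightarrow> real" where
  "gcost a g = (1/2) * (\<Sum>j<nbus a. \<Sum>k<nbus a. g j * Hm a j k * g k) + (\<Sum>k<nbus a. lv a k * g k)"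

definition feas :: "area_data \<Rightarrow> nat \<Rightarrow> (nat \<Rightarrow> real) \<Rightarrow> (nat \<Rightarrow> real) \<Rightarrow> (nat \<Rightarrow> real) set" where
  "feas a I qn d = {g. (\<forall>k. nbus a \<le> k \<longrightarrow> g k = 0)
      \<and> (\<forall>r<ncon a. (\<Sum>k<nbus a. Gc a r k * g k) \<le> gb a r)
      \<and> (\<Sum>k<nbus a. d k - g k) + (\<Sum>i\<in>{1..I}. qn i) = 0
      \<and> (\<forall>m<nline a. (\<Sum>k<nbus a. Am a m k * (d k - g k)) + (\<Sum>i\<in>{1..I}. Bm a m i * qn i) \<le> Fv a m)}"

definition is_opt :: "area_data \<Rightarrow> nat \<Rightarrow> (nat \<Rightarrow> real) \<Rightarrow> (nat \<Rightarrow> real) \<Rightarrow> (nat \<Rightarrow> real) \<Rightarrow> bool" where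
  "is_opt a I qn d g \<longleftrightarrow> g \<in> feas a I qn d \<and> (\<forall>g'\<in>feas a I qn d. gcost a g \<le> gcost a g')"

definition gstar :: "area_data \<Rightarrow> nat \<Rightarrow> (nat \<Rightarrow> real) \<Rightarrow> (nat \<Rightarrow> real) \<Rightarrow> (nat \<Rightarrow> real)" where
  "gstar a I qn d = (THE g. is_opt a I qn d g)"

definition act_con :: "area_data \<Rightarrow> (nat \<Rightarrow> real) \<Rightarrow> nat set" where
  "act_con a g = {r. r < ncon a \<and> (\<Sum>k<nbus a. Gc a r k * g k) = gb a r}"

definition act_line :: "area_data \<Rightarrow> nat \<Rightarrow> (nat \<Rightarrow> real) \<Rightarrow> (nat \<Rightarrow> real) \<Rightarrow> (nat \<Rightarrow> real) \<Rightarrow> nat set" where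
  "act_line a I qn d g = {m. m < nline a \<and>
     (\<Sum>k<nbus a. Am a m k * (d k - g k)) + (\<Sum>i\<in>{1..I}. Bm a m i * qn i) = Fv a m}"

text \<open>Primal nondegeneracy (LICQ): the gradients (w.r.t. g) of the equality constraint
  and of all active inequality constraints are linearly independent.\<close>
definition primal_nondeg :: "area_data \<Rightarrow> nat \<Rightarrow> (nat \<Rightarrow> real) \<Rightarrow> (nat \<Rightarrow> real) \<Rightarrow> (nat \<Rightarrow> real) \<Rightarrow> bool" where
  "primal_nondeg a I qn d g \<longleftrightarrow>
     (\<forall>(c0::real) (cr::nat\<Rightarrow>real) (cm::nat\<Rightarrow>real).
        (\<forall>k<nbus a. c0 + (\<Sum>r\<in>act_con a g. cr r * Gc a r k)
                      - (\<Sum>m\<in>act_line a I qn d g. cm m * Am a m k) = 0)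
        \<longrightarrow> c0 = 0 \<and> (\<forall>r\<in>act_con a g. cr r = 0) \<and> (\<forall>m\<in>act_line a I qn d g. cm m = 0))"

text \<open>Dual nondegeneracy (strict complementarity): there are KKT multipliers at g for which
  every active inequality constraint has a strictly positive multiplier.
  Inequalities in <= form with gradients Gc r (polyhedral rows) and -Am m (line rows);
  equality constraint with gradient (1,...,1).\<close>
definition dual_nondeg :: "area_data \<Rightarrow> nat \<Rightarrow> (nat \<Rightarrow> real) \<Rightarrow> (nat \<Rightarrow> real) \<Rightarrow> (nat \<Rightarrow> real) \<Rightarrow> bool" where
  "dual_nondeg a I qn d g \<longleftrightarrow>
     (\<exists>(nu::real) (lr::nat\<Rightarrow>real) (lm::nat\<Rightarrow>real).
        (\<forall>k<nbus a. (\<Sum>j<nbus a. Hm a k j * g j) + lv a k + nu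
                    + (\<Sum>r\<in>act_con a g. lr r * Gc a r k)
                    - (\<Sum>m\<in>act_line a I qn d g. lm m * Am a m k) = 0)
        \<and> (\<forall>r\<in>act_con a g. lr r > 0) \<and> (\<forall>m\<in>act_line a I qn d g. lm m > 0))"

definition nondegenerate :: "area_data \<Rightarrow> nat \<Rightarrow> (nat \<Rightarrow> real) \<Rightarrow> (nat \<Rightarrow> real) \<Rightarrow> bool" where
  "nondegenerate a I qn d \<longleftrightarrow>
     (\<exists>g. is_opt a I qn d g \<and> primal_nondeg a I qn d g \<and> dual_nondeg a I qn d g)"

definition Cbar :: "nat \<Rightarrow> nat \<Rightarrow> (nat \<Rightarrow> nat) \<Rightarrow> (nat \<Rightarrow> nat) \<Rightarrow> (nat \<Rightarrow> area_data)
                     \<Rightarrow> (nat \<Rightarrow> (nat \<Rightarrow> real) measure) \<Rightarrow> (nat \<Rightarrow> real) \<Rightarrow> real" where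
  "Cbar N I orig dest ar F q =
     (\<Sum>n\<in>{1..N}. integral\<^sup>L (F n) (\<lambda>d. gcost (ar n) (gstar (ar n) I (qloc I orig dest q n) d)))"

end

theory Submission
  imports Defs
begin

text \<open>For a fixed load the KKT multipliers give a subgradient of the second-stage value function, and
  linear independence of the active constraints turns it into a gradient. Together with convexity,
  a point that minimizes \<^const>\<open>Cbar\<close> in each coordinate separately is therefore a minimizer.

  Generation balances net exports and the costs are coercive, so coordinate steps inside a sublevel
  set are bounded. Hence, along a subsequence converging to a limit point, the successive iterates
  also have limits; all of these have the same value, and each is minimal in the coordinate
  about to be updated. Joint minimality over two coordinates carries the minimality in a
  later coordinate back from the limit of the successors, so the limit point is minimal in every
  coordinate.\<close>

subsection \<open>Lower limits of real sequences\<close>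

definition le_liminf :: "real \<Rightarrow> (nat \<Rightarrow> real) \<Rightarrow> bool" where
  "le_liminf y X \<longleftrightarrow> (\<forall>a<y. \<forall>\<^sub>F k in sequentially. a < X k)"

lemma le_liminf_mono:
  assumes "le_liminf y X" "y' \<le> y" "\<forall>\<^sub>F k in sequentially. X k \<le> X' k"
  shows "le_liminf y' X'"
  unfolding le_liminf_def
proof (intro allI impI)
  fix a assume "a < y'"
  then have "\<forall>\<^sub>F k in sequentially. a < X k" using assms(1,2) by (auto simp: le_liminf_def)
  with assms(3) show "\<forall>\<^sub>F k in sequentially. a < X' k" by eventually_elim simp
qed

lemma tendsto_le_liminf: "X \<longlonglongrightarrow> y \<Longrightarrow> le_liminf y X"
  by (auto simp: le_liminf_def dest: order_tendstoD(1))

lemma le_liminf_iff_tendsto_min: "le_liminf y X \<longleftrightarrow> (\<lambda>k. min (X k) y) \<longlonglongrightarrow> y"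
proof
  assume "le_liminf y X"
  then show "(\<lambda>k. min (X k) y) \<longlonglongrightarrow> y"
    by (intro order_tendstoI) (auto simp: le_liminf_def min_less_iff_disj)
next
  assume "(\<lambda>k. min (X k) y) \<longlonglongrightarrow> y"
  then show "le_liminf y X"
    by (rule le_liminf_mono[OF tendsto_le_liminf]) auto
qed

lemma le_liminf_sum:
  assumes "\<And>n. n \<in> A \<Longrightarrow> le_liminf (y n) (X n)"
  shows "le_liminf (\<Sum>n\<in>A. y n) (\<lambda>k. \<Sum>n\<in>A. X n k)"
proof (rule le_liminf_mono[OF tendsto_le_liminf])
  show "(\<lambda>k. \<Sum>n\<in>A. min (X n k) (y n)) \<longlonglongrightarrow> (\<Sum>n\<in>A. y n)"
    using assms by (intro tendsto_sum) (simp add: le_liminf_iff_tendsto_min)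
qed (auto intro!: always_eventually sum_mono)

lemma le_liminf_bounded:
  assumes "le_liminf y X" "\<And>k. X k \<le> b"
  shows "y \<le> b"
proof (rule ccontr)
  assume "\<not> y \<le> b"
  with assms(1) have "\<forall>\<^sub>F k in sequentially. b < X k" by (simp add: le_liminf_def)
  then have "\<exists>k. b < X k" by (rule eventually_happens'[OF sequentially_bot])
  with assms(2) show False by (simp add: linorder_not_less[symmetric])
qed

lemma le_liminf_integral:
  fixes X :: "nat \<Rightarrow> 'a \<Rightarrow> real"
  assumes integrable_seq: "\<And>k. integrable M (X k)" and integrable_limit: "integrable M Y"
    and integrable_minorant: "integrable M W"
    and minorant: "\<And>k. AE x in M. W x \<le> X k x"
    and liminf: "AE x in M. le_liminf (Y x) (\<lambda>k. X k x)"
  shows "le_liminf (integral\<^sup>L M Y) (\<lambda>k. integral\<^sup>L M (X k))"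
proof (rule le_liminf_mono[OF tendsto_le_liminf order_refl always_eventually[OF allI]])
  have integrable_min: "integrable M (\<lambda>x. min (X k x) (Y x))" for k
    by (intro Bochner_Integration.integrable_min integrable_seq integrable_limit)
  show "(\<lambda>k. integral\<^sup>L M (\<lambda>x. min (X k x) (Y x))) \<longlonglongrightarrow> integral\<^sup>L M Y"
  proof (rule integral_dominated_convergence[where w = "\<lambda>x. \<bar>W x\<bar> + \<bar>Y x\<bar>"])
    show "AE x in M. norm (min (X k x) (Y x)) \<le> \<bar>W x\<bar> + \<bar>Y x\<bar>" for k
      using minorant[of k] by eventually_elim auto
    show "AE x in M. (\<lambda>k. min (X k x) (Y x)) \<longlonglongrightarrow> Y x"
      using liminf by (simp add: le_liminf_iff_tendsto_min)
  qed (use integrable_limit integrable_minorant integrable_min in auto)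
  show "integral\<^sup>L M (\<lambda>x. min (X k x) (Y x)) \<le> integral\<^sup>L M (X k)" for k
    by (intro integral_mono integrable_min integrable_seq) simp
qed

subsection \<open>Coordinatewise convergence and convexity\<close>

definition converges_on :: "'i set \<Rightarrow> (nat \<Rightarrow> 'i \<Rightarrow> 'a::topological_space) \<Rightarrow> ('i \<Rightarrow> 'a) \<Rightarrow> bool" where
  "converges_on A X x \<longleftrightarrow> (\<forall>i\<in>A. (\<lambda>k. X k i) \<longlonglongrightarrow> x i)"

lemma converges_on_subseq:
  assumes "converges_on A X x" "strict_mono \<sigma>"
  shows "converges_on A (\<lambda>k. X (\<sigma> k)) x"
  unfolding converges_on_def
proof
  fix i assume "i \<in> A"
  then show "(\<lambda>k. X (\<sigma> k) i) \<longlonglongrightarrow> x i"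
    using assms LIMSEQ_subseq_LIMSEQ[of "\<lambda>k. X k i" "x i" \<sigma>] by (simp add: converges_on_def o_def)
qed

lemma converges_on_Pi_closed:
  assumes "converges_on A X x" "\<And>k. X k \<in> Pi A S" "\<And>i. i \<in> A \<Longrightarrow> closed (S i)"
  shows "x \<in> Pi A S"
proof
  fix i assume "i \<in> A"
  then show "x i \<in> S i"
    using assms by (auto simp: converges_on_def Pi_iff intro: closed_sequentially[of _ "\<lambda>k. X k i"])
qed

definition mix :: "real \<Rightarrow> ('i \<Rightarrow> real) \<Rightarrow> ('i \<Rightarrow> real) \<Rightarrow> 'i \<Rightarrow> real" where
  "mix t x y = (\<lambda>i. (1 - t) * x i + t * y i)"

lemma mix_self: "mix t x x = x"
  by (simp add: mix_def fun_eq_iff algebra_simps)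

lemma mix_in_Pi:
  assumes "x \<in> Pi A S" "y \<in> Pi A S" "t \<in> {0..1}" "\<And>i. i \<in> A \<Longrightarrow> convex (S i)"
  shows "mix t x y \<in> Pi A S"
  using assms by (auto simp: mix_def convex_alt Pi_iff)

text \<open>Function types are not real vector spaces, so \<^const>\<open>convex_on\<close> does not apply to them.\<close>

definition mix_convex_on :: "('i \<Rightarrow> real) set \<Rightarrow> (('i \<Rightarrow> real) \<Rightarrow> real) \<Rightarrow> bool" where
  "mix_convex_on S f \<longleftrightarrow>
     (\<forall>x\<in>S. \<forall>y\<in>S. \<forall>t\<in>{0..1}. f (mix t x y) \<le> (1 - t) * f x + t * f y)"

lemma mix_convex_onD:
  assumes "mix_convex_on S f" "x \<in> S" "y \<in> S" "t \<in> {0..1}"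
  shows "f (mix t x y) \<le> (1 - t) * f x + t * f y"
  using assms by (simp add: mix_convex_on_def)

lemma mix_convex_on_le_max_ends:
  assumes convex_f: "mix_convex_on S f" and ends_in: "z(i := l) \<in> S" "z(i := u) \<in> S"
    and "l \<le> z i" "z i \<le> u"
  shows "f z \<le> max (f (z(i := l))) (f (z(i := u)))"
proof -
  have "z i \<in> closed_segment l u"
    using assms(4,5) by (auto simp: closed_segment_eq_real_ivl)
  then obtain t where weight_in: "t \<in> {0..1}" and coordinate_eq: "z i = (1 - t) * l + t * u"
    by (auto simp: in_segment)
  have "z = mix t (z(i := l)) (z(i := u))"
    using coordinate_eq by (auto simp: mix_def fun_eq_iff algebra_simps)
  then have "f z \<le> (1 - t) * f (z(i := l)) + t * f (z(i := u))"
    using mix_convex_onD[OF convex_f ends_in weight_in] by simp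
  also have "\<dots> \<le> max (f (z(i := l))) (f (z(i := u)))"
    using weight_in by (intro convex_bound_le) auto
  finally show ?thesis .
qed

definition face_box :: "'i set \<Rightarrow> ('i \<Rightarrow> real) \<Rightarrow> ('i \<Rightarrow> real) \<Rightarrow> ('i \<Rightarrow> real) \<Rightarrow> ('i \<Rightarrow> real) set" where
  "face_box A l u x = {z. (\<forall>i\<in>A. l i \<le> z i \<and> z i \<le> u i) \<and> (\<forall>i. i \<notin> A \<longrightarrow> z i = x i)}"

lemma mix_convex_bounded_on_face_box:
  assumes "finite A" "mix_convex_on S f" "face_box A l u x \<subseteq> S" "\<And>i. i \<in> A \<Longrightarrow> l i \<le> u i"
  shows "\<exists>b. \<forall>z\<in>face_box A l u x. f z \<le> b"
  using assms(1,3,4)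
proof (induction A arbitrary: x rule: finite_induct)
  case empty
  have "z = x" if "z \<in> face_box {} l u x" for z
    using that by (auto simp: face_box_def)
  then show ?case by auto
next
  case (insert i A)
  have facet: "\<exists>b. \<forall>z\<in>face_box A l u (x(i := v)). f z \<le> b" if "v \<in> {l i, u i}" for v
  proof (rule insert.IH)
    show "face_box A l u (x(i := v)) \<subseteq> S"
      using insert.prems(1) insert.prems(2)[of i] insert.hyps that
      by (auto simp: face_box_def subset_iff split: if_splits)
  qed (use insert.prems(2) in auto)
  obtain b b' where lower_facet: "\<forall>z\<in>face_box A l u (x(i := l i)). f z \<le> b"
    and upper_facet: "\<forall>z\<in>face_box A l u (x(i := u i)). f z \<le> b'"
    using facet[of "l i"] facet[of "u i"] by auto
  have "f z \<le> max b b'" if z_in: "z \<in> face_box (insert i A) l u x" for z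
  proof -
    have "z(i := l i) \<in> S" "z(i := u i) \<in> S"
      using z_in insert.prems by (auto simp: face_box_def subset_iff)
    then have "f z \<le> max (f (z(i := l i))) (f (z(i := u i)))"
      using z_in by (intro mix_convex_on_le_max_ends[OF assms(2)]) (auto simp: face_box_def)
    also have "\<dots> \<le> max b b'"
      using lower_facet upper_facet z_in insert.hyps by (intro max.mono) (auto simp: face_box_def)
    finally show ?thesis .
  qed
  then show ?case by blast
qed

text \<open>A cap active at \<open>x\<close> is respected by \<open>x + (X k - x) / t\<close> because \<open>X k\<close> respects it.\<close>

lemma eventually_dilation_in_face_box:
  fixes u :: "'i \<Rightarrow> real"
  assumes finite_A: "finite A" and seq_in: "\<And>k. X k \<in> Pi A (\<lambda>i. {..u i})"
    and x_in: "x \<in> Pi A (\<lambda>i. {..u i})"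
    and lim: "converges_on A X x" and t_pos: "0 < t"
  shows "\<forall>\<^sub>F k in sequentially. (\<lambda>i. if i \<in> A then x i + (X k i - x i) / t else x i)
    \<in> face_box A (\<lambda>i. x i - 1) (\<lambda>i. min (x i + 1) (u i)) x"
proof -
  have "\<forall>\<^sub>F k in sequentially. \<forall>i\<in>A. x i - 1 < x i + (X k i - x i) / t
      \<and> x i + (X k i - x i) / t < x i + 1 \<and> x i + (X k i - x i) / t \<le> u i"
  proof (intro eventually_ball_finite finite_A ballI)
    fix i assume i_in: "i \<in> A"
    have "(\<lambda>k. x i + (X k i - x i) / t) \<longlonglongrightarrow> x i + (x i - x i) / t"
      using lim i_in t_pos by (intro tendsto_intros) (auto simp: converges_on_def)
    then have dilation_lim: "(\<lambda>k. x i + (X k i - x i) / t) \<longlonglongrightarrow> x i" by simp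
    have "\<forall>\<^sub>F k in sequentially. x i + (X k i - x i) / t \<le> u i"
    proof (cases "x i < u i")
      case True
      from order_tendstoD(2)[OF dilation_lim this] show ?thesis by eventually_elim simp
    next
      case False
      with x_in i_in have "x i = u i" by (force simp: Pi_iff)
      then show ?thesis
        using seq_in i_in t_pos
        by (intro always_eventually allI) (simp add: Pi_iff divide_nonpos_pos)
    qed
    moreover have "\<forall>\<^sub>F k in sequentially. x i - 1 < x i + (X k i - x i) / t"
      "\<forall>\<^sub>F k in sequentially. x i + (X k i - x i) / t < x i + 1"
      by (intro order_tendstoD[OF dilation_lim], simp)+
    ultimately show "\<forall>\<^sub>F k in sequentially. x i - 1 < x i + (X k i - x i) / t
        \<and> x i + (X k i - x i) / t < x i + 1 \<and> x i + (X k i - x i) / t \<le> u i"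
      by eventually_elim simp
  qed
  then show ?thesis
    by eventually_elim (auto simp: face_box_def less_imp_le)
qed

lemma mix_convex_on_orthant_usc:
  fixes u :: "'i \<Rightarrow> real"
  assumes finite_A: "finite A" and convex_f: "mix_convex_on (Pi A (\<lambda>i. {..u i})) f"
    and cong: "\<And>y z. (\<And>i. i \<in> A \<Longrightarrow> y i = z i) \<Longrightarrow> f y = f z"
    and seq_in: "\<And>k. X k \<in> Pi A (\<lambda>i. {..u i})" and x_in: "x \<in> Pi A (\<lambda>i. {..u i})"
    and lim: "converges_on A X x" and "f x < a"
  shows "\<forall>\<^sub>F k in sequentially. f (X k) < a"
proof -
  let ?box = "face_box A (\<lambda>i. x i - 1) (\<lambda>i. min (x i + 1) (u i)) x"
  have box_subset: "?box \<subseteq> Pi A (\<lambda>i. {..u i})" by (auto simp: face_box_def)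
  moreover have "x i - 1 \<le> min (x i + 1) (u i)" if "i \<in> A" for i
    using x_in that by (fastforce simp: Pi_iff)
  ultimately obtain b where box_bound: "\<forall>z\<in>?box. f z \<le> b"
    using mix_convex_bounded_on_face_box[OF finite_A convex_f,
        of "\<lambda>i. x i - 1" "\<lambda>i. min (x i + 1) (u i)" x] by blast
  have "((\<lambda>t. (1 - t) * f x + t * b) \<longlongrightarrow> (1 - 0) * f x + 0 * b) (at_right 0)"
    by (intro tendsto_intros)
  then have "\<forall>\<^sub>F t in at_right 0. (1 - t) * f x + t * b < a"
    using \<open>f x < a\<close> by (intro order_tendstoD(2)) auto
  moreover have "\<forall>\<^sub>F t in at_right 0. 0 < t \<and> t < (1::real)"
    by (rule eventually_at_rightI[of 0 1]) auto
  ultimately have "\<forall>\<^sub>F t in at_right 0. (1 - t) * f x + t * b < a \<and> 0 < t \<and> t < 1"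
    by eventually_elim simp
  then obtain t where t_bounds: "(1 - t) * f x + t * b < a" "0 < t" "t < 1"
    using eventually_happens'[OF trivial_limit_at_right_real] by blast
  from eventually_dilation_in_face_box[OF finite_A seq_in x_in lim t_bounds(2)] show ?thesis
  proof eventually_elim
    case (elim k)
    define e where "e = (\<lambda>i. if i \<in> A then x i + (X k i - x i) / t else x i)"
    have "f (X k) = f (mix t x e)"
      using t_bounds by (intro cong) (simp add: mix_def e_def field_simps)
    also have "\<dots> \<le> (1 - t) * f x + t * f e"
      using t_bounds box_subset elim by (intro mix_convex_onD[OF convex_f x_in]) (auto simp: e_def)
    also have "\<dots> \<le> (1 - t) * f x + t * b"
      using t_bounds box_bound elim by (intro add_left_mono mult_left_mono) (auto simp: e_def)
    also note t_bounds(1)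
    finally show ?case .
  qed
qed

definition coordinate_step :: "real \<Rightarrow> ('i \<Rightarrow> real) \<Rightarrow> ('i \<Rightarrow> real) \<Rightarrow> 'i \<Rightarrow> 'i \<Rightarrow> real" where
  "coordinate_step h x y i = x(i := x i + h * (y i - x i))"

definition coordinate_quotient ::
    "'i set \<Rightarrow> (('i \<Rightarrow> real) \<Rightarrow> real) \<Rightarrow> ('i \<Rightarrow> real) \<Rightarrow> ('i \<Rightarrow> real) \<Rightarrow> real \<Rightarrow> real" where
  "coordinate_quotient A f x y h = (\<Sum>i\<in>A. (f (coordinate_step h x y i) - f x) / h)"

lemma coordinate_step_1: "coordinate_step 1 x y i = x(i := y i)"
  by (simp add: coordinate_step_def)

lemma coordinate_step_eq_mix: "coordinate_step h x y i = mix h x (x(i := y i))"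
  by (auto simp: coordinate_step_def mix_def fun_eq_iff algebra_simps)

lemma coordinate_step_in_Pi:
  assumes "x \<in> Pi A S" "y \<in> Pi A S" "h \<in> {0..1}" "\<And>i. i \<in> A \<Longrightarrow> convex (S i)"
  shows "coordinate_step h x y i \<in> Pi A S"
  unfolding coordinate_step_eq_mix using assms by (intro mix_in_Pi) (auto simp: Pi_iff)

lemma coordinate_quotient_sum:
  "coordinate_quotient A (\<lambda>q. \<Sum>n\<in>B. f n q) x y h = (\<Sum>n\<in>B. coordinate_quotient A (f n) x y h)"
  unfolding coordinate_quotient_def
  by (subst sum.swap) (simp add: sum_subtractf[symmetric] sum_divide_distrib)

lemma integral_coordinate_quotient:
  assumes "integrable M (f x)" "\<And>i. i \<in> A \<Longrightarrow> integrable M (f (coordinate_step h x y i))"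
  shows "integrable M (\<lambda>d. coordinate_quotient A (\<lambda>q. f q d) x y h)"
    and "(\<integral>d. coordinate_quotient A (\<lambda>q. f q d) x y h \<partial>M)
      = coordinate_quotient A (\<lambda>q. integral\<^sup>L M (f q)) x y h"
  using assms unfolding coordinate_quotient_def by auto

definition harmonic :: "nat \<Rightarrow> real" where
  "harmonic m = inverse (real (Suc m))"

lemma harmonic_pos: "0 < harmonic m"
  by (simp add: harmonic_def)

lemma harmonic_in: "harmonic m \<in> {0..1}"
  by (simp add: harmonic_def field_simps)

lemma filterlim_harmonic: "filterlim harmonic (at_right 0) sequentially"
  unfolding harmonic_def
  by (rule tendsto_imp_filterlim_at_right[OF LIMSEQ_inverse_real_of_nat]) simp

subsection \<open>Cyclic block descent\<close>

lemma constant_residue_subsequence: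
  fixes \<sigma> :: "nat \<Rightarrow> nat"
  assumes "0 < m"
  shows "\<exists>r (\<rho> :: nat \<Rightarrow> nat). strict_mono \<rho> \<and> (\<forall>k. \<sigma> (\<rho> k) mod m = r)"
proof -
  have "\<exists>r\<in>{..<m}. infinite {k \<in> UNIV. \<sigma> k mod m = r}"
    by (rule pigeonhole_infinite_rel) (use assms in auto)
  then obtain r where infinite_class: "infinite {k. \<sigma> k mod m = r}" by auto
  have "strict_mono (enumerate {k. \<sigma> k mod m = r})"
    using infinite_class by (simp add: strict_mono_enumerate)
  moreover have "\<sigma> (enumerate {k. \<sigma> k mod m = r} k) mod m = r" for k
    using enumerate_in_set[OF infinite_class, of k] by simp
  ultimately show ?thesis by blast
qed

lemma decseq_tendsto_of_subseq:
  fixes X :: "nat \<Rightarrow> real"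
  assumes decreasing: "decseq X" and "strict_mono \<sigma>" and subseq_limit: "(\<lambda>k. X (\<sigma> k)) \<longlonglongrightarrow> l"
  shows "X \<longlonglongrightarrow> l"
proof -
  have "l \<le> X t" for t
  proof (rule LIMSEQ_le_const2[OF subseq_limit], intro exI[of _ t] allI impI)
    fix k assume "t \<le> k"
    also have "k \<le> \<sigma> k" by (rule seq_suble[OF \<open>strict_mono \<sigma>\<close>])
    finally show "X (\<sigma> k) \<le> X t" using decreasing by (simp add: decseq_def)
  qed
  then obtain l' where full_limit: "X \<longlonglongrightarrow> l'" using decseq_convergent[OF decreasing] by blast
  with assms have "l' = l"
    using LIMSEQ_subseq_LIMSEQ[OF full_limit \<open>strict_mono \<sigma>\<close>]
    by (auto simp: o_def intro: LIMSEQ_unique)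
  with full_limit show ?thesis by simp
qed

locale cyclic_block_descent =
  fixes I :: nat
    and S :: "nat \<Rightarrow> 'b::heine_borel set"
    and f :: "(nat \<Rightarrow> 'b) \<Rightarrow> real"
    and q :: "nat \<Rightarrow> nat \<Rightarrow> 'b"
  assumes blocks_nonempty: "0 < I"
    and closed_block: "i \<in> {1..I} \<Longrightarrow> closed (S i)"
    and f_cong: "(\<And>i. i \<in> {1..I} \<Longrightarrow> x i = y i) \<Longrightarrow> f x = f y"
    and f_continuous: "(\<And>k. X k \<in> Pi {1..I} S) \<Longrightarrow> converges_on {1..I} X x \<Longrightarrow> (\<lambda>k. f (X k)) \<longlonglongrightarrow> f x"
    and blockwise_min_imp_min: "x \<in> Pi {1..I} S \<Longrightarrow> y \<in> Pi {1..I} S \<Longrightarrow>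
        (\<And>i z. i \<in> {1..I} \<Longrightarrow> y i \<noteq> x i \<Longrightarrow> z \<in> S i \<Longrightarrow> f x \<le> f (x(i := z))) \<Longrightarrow> f x \<le> f y"
    and step_bounded: "\<exists>R. \<forall>x\<in>Pi {1..I} S. \<forall>i\<in>{1..I}. \<forall>z\<in>S i.
        f x \<le> l \<longrightarrow> f (x(i := z)) \<le> l \<longrightarrow> dist z (x i) \<le> R"
    and iterate_in: "q t \<in> Pi {1..I} S"
    and iterate_keep: "j \<in> {1..I} \<Longrightarrow> j \<noteq> t mod I + 1 \<Longrightarrow> q (Suc t) j = q t j"
    and iterate_min: "z \<in> S (t mod I + 1) \<Longrightarrow> f (q (Suc t)) \<le> f ((q t)(t mod I + 1 := z))"
begin

abbreviation block :: "nat \<Rightarrow> nat" where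
  "block t \<equiv> t mod I + 1"

definition cycle_limit :: "nat \<Rightarrow> (nat \<Rightarrow> 'b) \<Rightarrow> bool" where
  "cycle_limit r w \<longleftrightarrow> (\<exists>\<tau>. strict_mono \<tau> \<and> (\<forall>k. \<tau> k mod I = r mod I)
     \<and> converges_on {1..I} (\<lambda>k. q (\<tau> k)) w)"

lemma block_in: "block t \<in> {1..I}"
  using blocks_nonempty by (simp add: Suc_leI)

lemma upd_in_Pi:
  assumes "x \<in> Pi {1..I} S" "z \<in> S i"
  shows "x(i := z) \<in> Pi {1..I} S"
  using assms by (auto simp: Pi_iff)

lemma f_iterate_Suc: "f (q (Suc t)) = f ((q t)(block t := q (Suc t) (block t)))"
  by (rule f_cong) (simp add: iterate_keep)

lemma decseq_f_iterates: "decseq (\<lambda>t. f (q t))"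
proof (rule decseq_SucI)
  fix t
  show "f (q (Suc t)) \<le> f (q t)"
    using iterate_min[of "q t (block t)" t] iterate_in[of t] block_in[of t] by (auto simp: Pi_iff)
qed

lemma cycle_limit_in:
  assumes "cycle_limit r w"
  shows "w \<in> Pi {1..I} S"
  using assms converges_on_Pi_closed[OF _ iterate_in closed_block] unfolding cycle_limit_def
  by blast

lemma cycle_limit_value:
  assumes "cycle_limit r w"
  shows "(\<lambda>t. f (q t)) \<longlonglongrightarrow> f w"
  using assms decseq_tendsto_of_subseq[OF decseq_f_iterates] f_continuous[OF iterate_in]
  unfolding cycle_limit_def by blast

lemma cycle_limit_value_eq:
  assumes "cycle_limit r w" "cycle_limit s w'"
  shows "f w = f w'"
  using assms by (blast intro: LIMSEQ_unique cycle_limit_value)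

lemma cycle_limit_min_block:
  assumes w_limit: "cycle_limit r w" and z_in: "z \<in> S (block r)"
  shows "f w \<le> f (w(block r := z))"
proof -
  obtain \<tau> where subseq: "strict_mono \<tau>" "\<And>k. \<tau> k mod I = r mod I"
    and lim: "converges_on {1..I} (\<lambda>k. q (\<tau> k)) w"
    using w_limit unfolding cycle_limit_def by blast
  show ?thesis
  proof (rule LIMSEQ_le)
    show "(\<lambda>k. f (q (Suc (\<tau> k)))) \<longlonglongrightarrow> f w"
      using LIMSEQ_subseq_LIMSEQ[OF LIMSEQ_Suc[OF cycle_limit_value[OF w_limit]] subseq(1)]
      by (simp add: o_def)
    show "(\<lambda>k. f ((q (\<tau> k))(block r := z))) \<longlonglongrightarrow> f (w(block r := z))"
      using lim by (intro f_continuous upd_in_Pi iterate_in z_in) (simp add: converges_on_def)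
    show "\<exists>m. \<forall>k\<ge>m. f (q (Suc (\<tau> k))) \<le> f ((q (\<tau> k))(block r := z))"
      using iterate_min[of z "\<tau> _"] z_in by (simp add: subseq(2))
  qed
qed

lemma iterate_steps_bounded: "\<exists>R. \<forall>t. dist (q (Suc t) (block t)) (q t (block t)) \<le> R"
proof -
  obtain R where step_le: "\<forall>x\<in>Pi {1..I} S. \<forall>i\<in>{1..I}. \<forall>z\<in>S i.
      f x \<le> f (q 0) \<longrightarrow> f (x(i := z)) \<le> f (q 0) \<longrightarrow> dist z (x i) \<le> R"
    using step_bounded by blast
  have "dist (q (Suc t) (block t)) (q t (block t)) \<le> R" for t
  proof (rule step_le[rule_format])
    show "q (Suc t) (block t) \<in> S (block t)"
      using iterate_in[of "Suc t"] block_in[of t] by (simp add: Pi_iff)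
    show "f ((q t)(block t := q (Suc t) (block t))) \<le> f (q 0)"
      using decseq_f_iterates unfolding f_iterate_Suc[symmetric] by (simp add: decseq_def)
  qed (use decseq_f_iterates iterate_in block_in in \<open>auto simp: decseq_def\<close>)
  then show ?thesis by blast
qed

lemma cycle_limit_Suc:
  assumes "cycle_limit r w"
  shows "\<exists>v. cycle_limit (Suc r) (w(block r := v))"
proof -
  obtain \<tau> where subseq: "strict_mono \<tau>" "\<And>k. \<tau> k mod I = r mod I"
    and lim: "converges_on {1..I} (\<lambda>k. q (\<tau> k)) w"
    using assms unfolding cycle_limit_def by blast
  let ?i = "block r"
  obtain R where step_le: "\<And>k. dist (q (Suc (\<tau> k)) ?i) (q (\<tau> k) ?i) \<le> R"
    using iterate_steps_bounded subseq(2) by metis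
  have "bounded (range (\<lambda>k. q (\<tau> k) ?i))"
    using lim block_in by (intro convergent_imp_bounded) (auto simp: converges_on_def)
  then obtain a B where block_bound: "\<And>k. dist a (q (\<tau> k) ?i) \<le> B"
    by (auto simp: bounded_def)
  have "dist a (q (Suc (\<tau> k)) ?i) \<le> B + R" for k
    using dist_triangle_le[of a "q (\<tau> k) ?i" "q (Suc (\<tau> k)) ?i" "B + R"]
      block_bound[of k] step_le[of k]
    by (simp add: dist_commute)
  then have "bounded (range (\<lambda>k. q (Suc (\<tau> k)) ?i))" by (auto simp: bounded_def)
  then obtain v \<rho> where block_subseq: "strict_mono \<rho>"
    and block_limit: "(\<lambda>k. q (Suc (\<tau> (\<rho> k))) ?i) \<longlonglongrightarrow> v"
    using bounded_imp_convergent_subsequence by (fastforce simp: o_def)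
  have "cycle_limit (Suc r) (w(?i := v))"
    unfolding cycle_limit_def
  proof (intro exI[of _ "\<lambda>k. Suc (\<tau> (\<rho> k))"] conjI allI)
    show "strict_mono (\<lambda>k. Suc (\<tau> (\<rho> k)))"
      using subseq(1) block_subseq by (simp add: strict_mono_def)
    show "Suc (\<tau> (\<rho> k)) mod I = Suc r mod I" for k
      using subseq(2) by (metis mod_Suc_eq)
    have "q (Suc (\<tau> (\<rho> k))) j = q (\<tau> (\<rho> k)) j" if "j \<in> {1..I}" "j \<noteq> ?i" for j k
      using iterate_keep[OF that(1), of "\<tau> (\<rho> k)"] that(2) subseq(2) by simp
    then show "converges_on {1..I} (\<lambda>k. q (Suc (\<tau> (\<rho> k)))) (w(?i := v))"
      using block_limit converges_on_subseq[OF lim block_subseq] by (simp add: converges_on_def)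
  qed
  then show ?thesis by blast
qed

text \<open>The limit of the successors has the value of \<open>w\<close>. It is minimal in the block just updated and,
  inductively, in the later one, hence jointly in both; the competitor differs from it only there.\<close>

lemma cycle_limit_min_later_block:
  assumes "cycle_limit r w" "z \<in> S (block (r + j))"
  shows "f w \<le> f (w(block (r + j) := z))"
  using assms
proof (induction j arbitrary: r w z)
  case 0
  then show ?case unfolding add_0_right by (rule cycle_limit_min_block)
next
  case (Suc j)
  let ?i = "block r" and ?l = "block (r + Suc j)"
  obtain v where successor_limit: "cycle_limit (Suc r) (w(?i := v))"
    using cycle_limit_Suc[OF Suc.prems(1)] by blast
  have "f w = f (w(?i := v))" by (rule cycle_limit_value_eq[OF Suc.prems(1) successor_limit])
  also have "\<dots> \<le> f (w(?l := z))"
  proof (rule blockwise_min_imp_min)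
    fix m y assume m_changed: "(w(?l := z)) m \<noteq> (w(?i := v)) m" and y_in: "y \<in> S m"
    from m_changed consider (updated) "m = ?i" | (later) "m = ?l" by (auto split: if_splits)
    then show "f (w(?i := v)) \<le> f ((w(?i := v))(m := y))"
    proof cases
      case updated
      then show ?thesis
        using cycle_limit_min_block[OF Suc.prems(1)] y_in
          cycle_limit_value_eq[OF Suc.prems(1) successor_limit]
        by simp
    next
      case later
      show ?thesis
        using Suc.IH[OF successor_limit, of y] y_in unfolding later by (simp only: add_Suc_shift)
    qed
  qed (intro cycle_limit_in[OF successor_limit] upd_in_Pi cycle_limit_in[OF Suc.prems(1)] Suc.prems(2))+
  finally show ?case .
qed

lemma block_onto:
  assumes "i \<in> {1..I}"
  shows "\<exists>j. block (r + j) = i"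
proof -
  obtain l where l_less: "i = l + 1" "l < I"
    using assms by (intro that[of "i - 1"]) auto
  have "(r + (I - r mod I + l)) mod I = (r mod I + (I - r mod I + l)) mod I"
    by (simp add: mod_simps)
  also have "r mod I + (I - r mod I + l) = I + l"
    using mod_less_divisor[OF blocks_nonempty, of r] by linarith
  also have "\<dots> mod I = l" using l_less by simp
  finally show ?thesis using l_less by (intro exI[of _ "I - r mod I + l"]) simp
qed

theorem limit_point_minimal:
  assumes "strict_mono (\<sigma> :: nat \<Rightarrow> nat)" "converges_on {1..I} (\<lambda>k. q (\<sigma> k)) p"
    and y_in: "y \<in> Pi {1..I} S"
  shows "f p \<le> f y"
proof -
  obtain r and \<rho> :: "nat \<Rightarrow> nat" where residue_subseq: "strict_mono \<rho>" "\<And>k. \<sigma> (\<rho> k) mod I = r"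
    using constant_residue_subsequence[OF blocks_nonempty] by blast
  have "r mod I = r" using residue_subseq(2) by (metis mod_mod_trivial)
  then have p_limit: "cycle_limit r p"
    unfolding cycle_limit_def
    using assms(1) residue_subseq converges_on_subseq[OF assms(2) residue_subseq(1)]
    by (intro exI[of _ "\<lambda>k. \<sigma> (\<rho> k)"]) (auto simp: strict_mono_def)
  show ?thesis
  proof (rule blockwise_min_imp_min[OF cycle_limit_in[OF p_limit] y_in])
    fix i z assume "i \<in> {1..I}" "z \<in> S i"
    then show "f p \<le> f (p(i := z))"
      using cycle_limit_min_later_block[OF p_limit] block_onto[of i r] by metis
  qed
qed

end

subsection \<open>Independent rows\<close>

definition independent_rows :: "'s set \<Rightarrow> 'k set \<Rightarrow> ('s \<Rightarrow> 'k \<Rightarrow> 'a::field) \<Rightarrow> bool" where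
  "independent_rows S K A \<longleftrightarrow>
     (\<forall>c. (\<forall>k\<in>K. (\<Sum>s\<in>S. c s * A s k) = 0) \<longrightarrow> (\<forall>s\<in>S. c s = 0))"

lemma independent_rows_eliminate:
  assumes indep: "independent_rows (insert s S) K A" and "finite S" "s \<notin> S"
  shows "independent_rows S K (\<lambda>t l. A t l - m t * A s l)"
  unfolding independent_rows_def
proof (intro allI impI)
  fix c assume vanish: "\<forall>l\<in>K. (\<Sum>t\<in>S. c t * (A t l - m t * A s l)) = 0"
  define c' where "c' = c(s := - (\<Sum>t\<in>S. c t * m t))"
  have "(\<Sum>t\<in>insert s S. c' t * A t l) = (\<Sum>t\<in>S. c t * (A t l - m t * A s l))" for l
  proof -
    have "(\<Sum>t\<in>S. c' t * A t l) = (\<Sum>t\<in>S. c t * A t l)"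
      using assms(3) by (intro sum.cong) (auto simp: c'_def)
    then show ?thesis
      using assms(2,3)
      by (simp add: c'_def right_diff_distrib sum_subtractf sum_distrib_right mult.assoc)
  qed
  with vanish have "\<forall>t\<in>insert s S. c' t = 0"
    using indep unfolding independent_rows_def by presburger
  then show "\<forall>t\<in>S. c t = 0"
    using assms(3) by (metis c'_def fun_upd_other insertI2)
qed

lemma independent_rows_solvable:
  fixes A :: "'s \<Rightarrow> 'k \<Rightarrow> 'a::field"
  assumes "finite S" "finite K" "independent_rows S K A"
  shows "\<exists>u. \<forall>s\<in>S. (\<Sum>k\<in>K. A s k * u k) = b s"
  using assms(1,3)
proof (induction S arbitrary: A b rule: finite_induct)
  case empty
  then show ?case by simp
next
  case (insert s S)
  have "\<exists>k\<in>K. A s k \<noteq> 0"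
  proof (rule ccontr)
    assume "\<not> ?thesis"
    then have "\<forall>k\<in>K. (\<Sum>t\<in>insert s S. (if t = s then 1 else 0) * A t k) = 0"
      using insert.hyps by (auto intro!: sum.neutral)
    with insert.prems[unfolded independent_rows_def, rule_format, of "\<lambda>t. if t = s then 1 else 0" s]
    show False by simp
  qed
  then obtain k where k_in: "k \<in> K" and pivot: "A s k \<noteq> 0" by blast
  define m where "m t = A t k / A s k" for t
  obtain u where eliminated: "\<And>t. t \<in> S \<Longrightarrow> (\<Sum>l\<in>K. (A t l - m t * A s l) * u l) = b t - m t * b s"
    using insert.IH[OF independent_rows_eliminate[OF insert.prems insert.hyps, of m],
        of "\<lambda>t. b t - m t * b s"] by blast
  define v where "v = u(k := u k + (b s - (\<Sum>l\<in>K. A s l * u l)) / A s k)"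
  have update: "(\<Sum>l\<in>K. B l * v l) = (\<Sum>l\<in>K. B l * u l) + B k * (v k - u k)" for B
    using assms(2) k_in by (simp add: v_def sum.remove[of K k] algebra_simps)
  have pivot_row: "(\<Sum>l\<in>K. A s l * v l) = b s"
    using pivot by (simp add: update) (simp add: v_def)
  moreover have "(\<Sum>l\<in>K. A t l * v l) = b t" if "t \<in> S" for t
  proof -
    have "(\<Sum>l\<in>K. A t l * v l) = (\<Sum>l\<in>K. (A t l - m t * A s l) * v l) + m t * (\<Sum>l\<in>K. A s l * v l)"
      by (simp add: sum_distrib_left algebra_simps sum_subtractf)
    also have "(\<Sum>l\<in>K. (A t l - m t * A s l) * v l) = b t - m t * b s"
      using pivot eliminated[OF that] by (subst update) (simp add: m_def)
    finally show ?thesis by (simp add: pivot_row)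
  qed
  ultimately show ?case by blast
qed

subsection \<open>Quadratic generation costs\<close>

definition quad_form :: "area_data \<Rightarrow> (nat \<Rightarrow> real) \<Rightarrow> real" where
  "quad_form a v = (\<Sum>j<nbus a. \<Sum>k<nbus a. v j * Hm a j k * v k)"

definition posdef_cost :: "area_data \<Rightarrow> bool" where
  "posdef_cost a \<longleftrightarrow> (\<forall>j<nbus a. \<forall>k<nbus a. Hm a j k = Hm a k j)
     \<and> (\<forall>v. (\<exists>k<nbus a. v k \<noteq> 0) \<longrightarrow> quad_form a v > 0)"

definition cost_grad :: "area_data \<Rightarrow> (nat \<Rightarrow> real) \<Rightarrow> nat \<Rightarrow> real" where
  "cost_grad a g k = (\<Sum>j<nbus a. Hm a k j * g j) + lv a k"

lemma quad_form_nonneg: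
  assumes "posdef_cost a"
  shows "quad_form a v \<ge> 0"
proof (cases "\<exists>k<nbus a. v k \<noteq> 0")
  case True
  then show ?thesis using assms by (auto simp: posdef_cost_def intro: less_imp_le)
next
  case False
  then show ?thesis by (simp add: quad_form_def)
qed

lemma quad_form_scale: "quad_form a (\<lambda>k. t * v k) = t\<^sup>2 * quad_form a v"
  by (simp add: quad_form_def sum_distrib_left power2_eq_square mult_ac)

lemma gcost_add:
  assumes "posdef_cost a"
  shows "gcost a (\<lambda>k. g k + x k) = gcost a g + (\<Sum>k<nbus a. cost_grad a g k * x k) + quad_form a x / 2"
proof -
  have H_sym: "Hm a j k = Hm a k j" if "j < nbus a" "k < nbus a" for j k
    using assms that by (auto simp: posdef_cost_def)
  have cross: "(\<Sum>j<nbus a. \<Sum>k<nbus a. g j * Hm a j k * x k)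
      = (\<Sum>j<nbus a. \<Sum>k<nbus a. x j * Hm a j k * g k)"
    by (subst sum.swap) (auto intro!: sum.cong simp: H_sym)
  have "(\<Sum>j<nbus a. \<Sum>k<nbus a. (g j + x j) * Hm a j k * (g k + x k))
     = (\<Sum>j<nbus a. \<Sum>k<nbus a. g j * Hm a j k * g k) + (\<Sum>j<nbus a. \<Sum>k<nbus a. g j * Hm a j k * x k)
      + (\<Sum>j<nbus a. \<Sum>k<nbus a. x j * Hm a j k * g k) + quad_form a x"
    by (simp add: quad_form_def algebra_simps sum.distrib)
  moreover have "(\<Sum>k<nbus a. cost_grad a g k * x k)
      = (\<Sum>j<nbus a. \<Sum>k<nbus a. x j * Hm a j k * g k) + (\<Sum>k<nbus a. lv a k * x k)"
    by (simp add: cost_grad_def algebra_simps sum.distrib sum_distrib_left sum_distrib_right)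
  ultimately show ?thesis
    using cross by (simp add: gcost_def algebra_simps sum.distrib)
qed

lemma gcost_add_scaled:
  assumes "posdef_cost a"
  shows "gcost a (\<lambda>k. g k + t * x k)
    = gcost a g + t * (\<Sum>k<nbus a. cost_grad a g k * x k) + t\<^sup>2 * (quad_form a x / 2)"
  using gcost_add[OF assms, of g "\<lambda>k. t * x k"]
  by (simp add: quad_form_scale sum_distrib_left mult_ac)

lemma gcost_subgradient:
  assumes "posdef_cost a"
  shows "gcost a g + (\<Sum>k<nbus a. cost_grad a g k * (g' k - g k)) \<le> gcost a g'"
  using gcost_add[OF assms, of g "\<lambda>k. g' k - g k"] quad_form_nonneg[OF assms, of "\<lambda>k. g' k - g k"]
  by simp

lemma gcost_mix:
  assumes "posdef_cost a"
  shows "gcost a (mix t g g')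
    = (1 - t) * gcost a g + t * gcost a g' - t * (1 - t) * (quad_form a (\<lambda>k. g' k - g k) / 2)"
proof -
  define x where "x k = g' k - g k" for k
  have "gcost a g' = gcost a g + (\<Sum>k<nbus a. cost_grad a g k * x k) + quad_form a x / 2"
    using gcost_add[OF assms, of g x] by (simp add: x_def)
  moreover have "mix t g g' = (\<lambda>k. g k + t * x k)"
    by (simp add: mix_def x_def fun_eq_iff algebra_simps)
  ultimately show ?thesis
    unfolding x_def[symmetric]
    by (simp add: gcost_add_scaled[OF assms] power2_eq_square field_simps)
qed

lemma gcost_mix_le:
  assumes "posdef_cost a" "t \<in> {0..1}"
  shows "gcost a (mix t g g') \<le> (1 - t) * gcost a g + t * gcost a g'"
  using assms quad_form_nonneg by (simp add: gcost_mix)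

lemma gcost_ge_linear:
  assumes "posdef_cost a"
  shows "\<exists>c. \<forall>g. \<tau> * (\<Sum>k<nbus a. g k) - c \<le> gcost a g"
proof -
  have "independent_rows {..<nbus a} {..<nbus a} (Hm a)"
    unfolding independent_rows_def
  proof (intro allI impI)
    fix c assume vanish: "\<forall>k\<in>{..<nbus a}. (\<Sum>s<nbus a. c s * Hm a s k) = 0"
    have "quad_form a c = (\<Sum>k<nbus a. (\<Sum>s<nbus a. c s * Hm a s k) * c k)"
      unfolding quad_form_def by (subst sum.swap) (simp add: sum_distrib_right)
    also have "\<dots> = 0" using vanish by simp
    finally show "\<forall>s\<in>{..<nbus a}. c s = 0"
      using assms unfolding posdef_cost_def by (metis lessThan_iff less_irrefl)
  qed
  then obtain y where y_minimizer: "\<forall>s\<in>{..<nbus a}. (\<Sum>k<nbus a. Hm a s k * y k) = \<tau> - lv a s"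
    using independent_rows_solvable[of "{..<nbus a}" "{..<nbus a}" "Hm a" "\<lambda>s. \<tau> - lv a s"] by auto
  have "(\<Sum>k<nbus a. cost_grad a y k * (g k - y k))
      = \<tau> * (\<Sum>k<nbus a. g k) - \<tau> * (\<Sum>k<nbus a. y k)" for g
    using y_minimizer
    by (simp add: cost_grad_def sum_distrib_left sum_subtractf[symmetric] right_diff_distrib)
  then have "\<tau> * (\<Sum>k<nbus a. g k) - (\<tau> * (\<Sum>k<nbus a. y k) - gcost a y) \<le> gcost a g" for g
    using gcost_subgradient[OF assms, of y g] by simp
  then show ?thesis by blast
qed

lemma gcost_coercive:
  assumes "posdef_cost a"
  shows "\<exists>c\<ge>0. \<forall>g. \<bar>\<Sum>k<nbus a. g k\<bar> - c \<le> gcost a g"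
proof -
  obtain c c' where linear_bounds: "\<And>g. 1 * (\<Sum>k<nbus a. g k) - c \<le> gcost a g"
    "\<And>g. (- 1) * (\<Sum>k<nbus a. g k) - c' \<le> gcost a g"
    using gcost_ge_linear[OF assms] by metis
  have "\<bar>\<Sum>k<nbus a. g k\<bar> - (\<bar>c\<bar> + \<bar>c'\<bar>) \<le> gcost a g" for g
    using linear_bounds[of g] by linarith
  then show ?thesis by (intro exI[of _ "\<bar>c\<bar> + \<bar>c'\<bar>"]) auto
qed

subsection \<open>Second-stage value function\<close>

definition gen_lhs :: "area_data \<Rightarrow> (nat \<Rightarrow> real) \<Rightarrow> nat \<Rightarrow> real" where
  "gen_lhs a g r = (\<Sum>k<nbus a. Gc a r k * g k)"

definition imbalance :: "area_data \<Rightarrow> nat \<Rightarrow> (nat \<Rightarrow> real) \<Rightarrow> (nat \<Rightarrow> real) \<Rightarrow> (nat \<Rightarrow> real) \<Rightarrow> real" where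
  "imbalance a I qn d g = (\<Sum>k<nbus a. d k - g k) + (\<Sum>i\<in>{1..I}. qn i)"

definition line_flow :: "area_data \<Rightarrow> nat \<Rightarrow> (nat \<Rightarrow> real) \<Rightarrow> (nat \<Rightarrow> real) \<Rightarrow> (nat \<Rightarrow> real)
    \<Rightarrow> nat \<Rightarrow> real" where
  "line_flow a I qn d g m =
     (\<Sum>k<nbus a. Am a m k * (d k - g k)) + (\<Sum>i\<in>{1..I}. Bm a m i * qn i)"

definition opt_cost :: "area_data \<Rightarrow> nat \<Rightarrow> (nat \<Rightarrow> real) \<Rightarrow> (nat \<Rightarrow> real) \<Rightarrow> real" where
  "opt_cost a I qn d = gcost a (gstar a I qn d)"

lemma feas_iff:
  "g \<in> feas a I qn d \<longleftrightarrow> (\<forall>k\<ge>nbus a. g k = 0) \<and> (\<forall>r<ncon a. gen_lhs a g r \<le> gb a r)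
     \<and> imbalance a I qn d g = 0 \<and> (\<forall>m<nline a. line_flow a I qn d g m \<le> Fv a m)"
  by (simp add: feas_def gen_lhs_def imbalance_def line_flow_def)

lemma act_con_iff: "r \<in> act_con a g \<longleftrightarrow> r < ncon a \<and> gen_lhs a g r = gb a r"
  by (simp add: act_con_def gen_lhs_def)

lemma act_line_iff:
  "m \<in> act_line a I qn d g \<longleftrightarrow> m < nline a \<and> line_flow a I qn d g m = Fv a m"
  by (simp add: act_line_def line_flow_def)

lemma finite_act_con: "finite (act_con a g)"
  by (simp add: act_con_def)

lemma finite_act_line: "finite (act_line a I qn d g)"
  by (simp add: act_line_def)

lemma gen_lhs_combine: "gen_lhs a (\<lambda>k. s * g k + t * g' k) r = s * gen_lhs a g r + t * gen_lhs a g' r"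
  by (simp add: gen_lhs_def sum_distrib_left sum.distrib algebra_simps)

lemma imbalance_combine:
  "imbalance a I (\<lambda>i. s * qn i + t * qn' i) (\<lambda>k. s * d k + t * d' k) (\<lambda>k. s * g k + t * g' k)
    = s * imbalance a I qn d g + t * imbalance a I qn' d' g'"
  by (simp add: imbalance_def sum_distrib_left sum.distrib sum_subtractf algebra_simps)

lemma line_flow_combine:
  "line_flow a I (\<lambda>i. s * qn i + t * qn' i) (\<lambda>k. s * d k + t * d' k) (\<lambda>k. s * g k + t * g' k) m
    = s * line_flow a I qn d g m + t * line_flow a I qn' d' g' m"
  by (simp add: line_flow_def sum_distrib_left sum.distrib sum_subtractf algebra_simps)

lemma feas_mix:
  assumes "g \<in> feas a I qn d" "g' \<in> feas a I qn' d" "t \<in> {0..1}"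
  shows "mix t g g' \<in> feas a I (mix t qn qn') d"
proof -
  have flow: "line_flow a I (mix t qn qn') d (mix t g g') m
      = (1 - t) * line_flow a I qn d g m + t * line_flow a I qn' d g' m" for m
    using line_flow_combine[of a I "1 - t" qn t qn' d d g g' m] mix_self[of t d]
    by (simp add: mix_def)
  have balance: "imbalance a I (mix t qn qn') d (mix t g g')
      = (1 - t) * imbalance a I qn d g + t * imbalance a I qn' d g'"
    using imbalance_combine[of a I "1 - t" qn t qn' d d g g'] mix_self[of t d]
    by (simp add: mix_def)
  have gen: "gen_lhs a (mix t g g') r = (1 - t) * gen_lhs a g r + t * gen_lhs a g' r" for r
    by (simp add: mix_def gen_lhs_combine)
  show ?thesis
    using assms unfolding feas_iff gen balance flow
    by (auto simp: mix_def intro!: convex_bound_le)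
qed

lemma is_opt_unique:
  assumes posdef: "posdef_cost a" and optimal: "is_opt a I qn d g" "is_opt a I qn d g'"
  shows "g = g'"
proof (rule ccontr)
  assume "g \<noteq> g'"
  moreover have "\<forall>k\<ge>nbus a. g k = g' k" using optimal by (auto simp: is_opt_def feas_iff)
  ultimately have "\<exists>k<nbus a. g' k - g k \<noteq> 0"
    by (metis eq_iff_diff_eq_0 ext linorder_not_less)
  with posdef have "quad_form a (\<lambda>k. g' k - g k) > 0" by (auto simp: posdef_cost_def)
  moreover have "gcost a g' = gcost a g" using optimal by (auto simp: is_opt_def intro: antisym)
  ultimately have "gcost a (mix (1/2) g g') < gcost a g"
    by (simp add: gcost_mix[OF posdef])
  moreover have "mix (1/2) g g' \<in> feas a I qn d"
    using feas_mix[of g a I qn d g' qn "1/2"] optimal by (simp add: is_opt_def mix_self)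
  ultimately show False using optimal(1) by (auto simp: is_opt_def)
qed

lemma gstar_eq:
  assumes "posdef_cost a" "is_opt a I qn d g"
  shows "gstar a I qn d = g"
  unfolding gstar_def using assms is_opt_unique by (intro the_equality) auto

lemma nondegenerate_is_opt_gstar:
  assumes "posdef_cost a" "nondegenerate a I qn d"
  shows "is_opt a I qn d (gstar a I qn d)"
  using assms gstar_eq unfolding nondegenerate_def by metis

lemma nondegenerate_gstar_feas:
  assumes "posdef_cost a" "nondegenerate a I qn d"
  shows "gstar a I qn d \<in> feas a I qn d"
  using nondegenerate_is_opt_gstar[OF assms] by (simp add: is_opt_def)

lemma opt_cost_le:
  assumes "posdef_cost a" "nondegenerate a I qn d" "g \<in> feas a I qn d"
  shows "opt_cost a I qn d \<le> gcost a g"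
  using nondegenerate_is_opt_gstar[OF assms(1,2)] assms(3) by (simp add: opt_cost_def is_opt_def)

lemma opt_cost_mix_le:
  assumes posdef: "posdef_cost a" and weight_in: "t \<in> {0..1}"
    and nondeg: "nondegenerate a I qn d" "nondegenerate a I qn' d"
      "nondegenerate a I (mix t qn qn') d"
  shows "opt_cost a I (mix t qn qn') d \<le> (1 - t) * opt_cost a I qn d + t * opt_cost a I qn' d"
proof -
  have "mix t (gstar a I qn d) (gstar a I qn' d) \<in> feas a I (mix t qn qn') d"
    by (intro feas_mix nondegenerate_gstar_feas posdef nondeg weight_in)
  then have "opt_cost a I (mix t qn qn') d \<le> gcost a (mix t (gstar a I qn d) (gstar a I qn' d))"
    by (rule opt_cost_le[OF posdef nondeg(3)])
  also have "\<dots> \<le> (1 - t) * opt_cost a I qn d + t * opt_cost a I qn' d"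
    unfolding opt_cost_def by (rule gcost_mix_le[OF posdef weight_in])
  finally show ?thesis .
qed

subsection \<open>Gradient of the value function\<close>

definition stationary :: "area_data \<Rightarrow> nat \<Rightarrow> (nat \<Rightarrow> real) \<Rightarrow> (nat \<Rightarrow> real) \<Rightarrow> (nat \<Rightarrow> real)
    \<Rightarrow> real \<Rightarrow> (nat \<Rightarrow> real) \<Rightarrow> (nat \<Rightarrow> real) \<Rightarrow> bool" where
  "stationary a I qn d g nu lr lm \<longleftrightarrow>
     (\<forall>k<nbus a. cost_grad a g k + nu + (\<Sum>r\<in>act_con a g. lr r * Gc a r k)
                   - (\<Sum>m\<in>act_line a I qn d g. lm m * Am a m k) = 0)"

definition interface_price :: "area_data \<Rightarrow> nat \<Rightarrow> (nat \<Rightarrow> real) \<Rightarrow> (nat \<Rightarrow> real) \<Rightarrow> (nat \<Rightarrow> real)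
    \<Rightarrow> real \<Rightarrow> (nat \<Rightarrow> real) \<Rightarrow> nat \<Rightarrow> real" where
  "interface_price a I qn d g nu lm i = (\<Sum>m\<in>act_line a I qn d g. lm m * Bm a m i) - nu"

lemma stationary_cost_grad_inner:
  assumes "stationary a I qn d g nu lr lm"
  shows "(\<Sum>k<nbus a. cost_grad a g k * x k)
    = (\<Sum>i\<in>{1..I}. interface_price a I qn d g nu lm i * p i) + nu * imbalance a I p (\<lambda>_. 0) x
      - (\<Sum>r\<in>act_con a g. lr r * gen_lhs a x r)
      - (\<Sum>m\<in>act_line a I qn d g. lm m * line_flow a I p (\<lambda>_. 0) x m)"
proof -
  let ?R = "act_con a g" and ?L = "act_line a I qn d g"
  have "cost_grad a g k = - nu - (\<Sum>r\<in>?R. lr r * Gc a r k) + (\<Sum>m\<in>?L. lm m * Am a m k)"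
    if "k < nbus a" for k
    using assms that by (auto simp: stationary_def algebra_simps)
  then have "(\<Sum>k<nbus a. cost_grad a g k * x k)
      = (\<Sum>k<nbus a. - nu * x k - (\<Sum>r\<in>?R. lr r * Gc a r k * x k) + (\<Sum>m\<in>?L. lm m * Am a m k * x k))"
    by (intro sum.cong) (simp_all add: left_diff_distrib distrib_right sum_distrib_right)
  also have "\<dots> = - nu * (\<Sum>k<nbus a. x k) - (\<Sum>k<nbus a. \<Sum>r\<in>?R. lr r * Gc a r k * x k)
      + (\<Sum>k<nbus a. \<Sum>m\<in>?L. lm m * Am a m k * x k)"
    by (simp add: sum.distrib sum_subtractf sum_distrib_left sum_negf)
  also have "(\<Sum>k<nbus a. \<Sum>r\<in>?R. lr r * Gc a r k * x k) = (\<Sum>r\<in>?R. lr r * gen_lhs a x r)"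
    by (subst sum.swap) (simp add: gen_lhs_def sum_distrib_left mult_ac)
  also have "(\<Sum>k<nbus a. \<Sum>m\<in>?L. lm m * Am a m k * x k)
      = (\<Sum>m\<in>?L. lm m * (\<Sum>k<nbus a. Am a m k * x k))"
    by (subst sum.swap) (simp add: sum_distrib_left mult_ac)
  finally have "(\<Sum>k<nbus a. cost_grad a g k * x k) = - nu * (\<Sum>k<nbus a. x k)
      - (\<Sum>r\<in>?R. lr r * gen_lhs a x r) + (\<Sum>m\<in>?L. lm m * (\<Sum>k<nbus a. Am a m k * x k))" .
  moreover have "(\<Sum>i\<in>{1..I}. interface_price a I qn d g nu lm i * p i)
      = (\<Sum>m\<in>?L. lm m * (\<Sum>i\<in>{1..I}. Bm a m i * p i)) - nu * (\<Sum>i\<in>{1..I}. p i)"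
  proof -
    have "(\<Sum>m\<in>?L. lm m * (\<Sum>i\<in>{1..I}. Bm a m i * p i)) = (\<Sum>i\<in>{1..I}. \<Sum>m\<in>?L. lm m * Bm a m i * p i)"
      by (subst sum.swap) (simp add: sum_distrib_left mult_ac)
    then show ?thesis
      by (simp add: interface_price_def left_diff_distrib sum_subtractf
          sum_distrib_left sum_distrib_right)
  qed
  ultimately show ?thesis
    by (simp add: imbalance_def line_flow_def algebra_simps sum.distrib sum_subtractf sum_negf)
qed

lemma interface_price_subgradient:
  assumes posdef: "posdef_cost a" and stationary: "stationary a I qn d g nu lr lm"
    and lr_nonneg: "\<forall>r\<in>act_con a g. lr r \<ge> 0" and lm_nonneg: "\<forall>m\<in>act_line a I qn d g. lm m \<ge> 0"
    and feasible: "g \<in> feas a I qn d" "g' \<in> feas a I qn' d"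
  shows "gcost a g + (\<Sum>i\<in>{1..I}. interface_price a I qn d g nu lm i * (qn' i - qn i)) \<le> gcost a g'"
proof -
  define x where "x k = g' k - g k" for k
  define p where "p i = qn' i - qn i" for i
  have "imbalance a I p (\<lambda>_. 0) x = 0"
    using imbalance_combine[of a I 1 qn' "-1" qn d d g' g] feasible
    by (simp add: x_def[abs_def] p_def[abs_def] feas_iff)
  moreover have "(\<Sum>r\<in>act_con a g. lr r * gen_lhs a x r) \<le> 0"
  proof (intro sum_nonpos mult_nonneg_nonpos)
    fix r assume active: "r \<in> act_con a g"
    then show "gen_lhs a x r \<le> 0"
      using gen_lhs_combine[of a 1 g' "-1" g r] feasible
      by (simp add: x_def[abs_def] feas_iff act_con_iff)
    show "lr r \<ge> 0" using lr_nonneg active by blast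
  qed
  moreover have "(\<Sum>m\<in>act_line a I qn d g. lm m * line_flow a I p (\<lambda>_. 0) x m) \<le> 0"
  proof (intro sum_nonpos mult_nonneg_nonpos)
    fix m assume active: "m \<in> act_line a I qn d g"
    then show "line_flow a I p (\<lambda>_. 0) x m \<le> 0"
      using line_flow_combine[of a I 1 qn' "-1" qn d d g' g m] feasible
      by (simp add: x_def[abs_def] p_def[abs_def] feas_iff act_line_iff)
    show "lm m \<ge> 0" using lm_nonneg active by blast
  qed
  ultimately have "(\<Sum>i\<in>{1..I}. interface_price a I qn d g nu lm i * p i)
      \<le> (\<Sum>k<nbus a. cost_grad a g k * x k)"
    using stationary_cost_grad_inner[OF stationary, of x p] by simp
  then show ?thesis
    using gcost_subgradient[OF posdef, of g g'] by (simp add: x_def p_def)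
qed

definition active_direction :: "area_data \<Rightarrow> nat \<Rightarrow> (nat \<Rightarrow> real) \<Rightarrow> (nat \<Rightarrow> real) \<Rightarrow> (nat \<Rightarrow> real)
    \<Rightarrow> (nat \<Rightarrow> real) \<Rightarrow> (nat \<Rightarrow> real) \<Rightarrow> bool" where
  "active_direction a I qn d g p u \<longleftrightarrow> (\<forall>k\<ge>nbus a. u k = 0) \<and> imbalance a I p (\<lambda>_. 0) u = 0
     \<and> (\<forall>r\<in>act_con a g. gen_lhs a u r = 0)
     \<and> (\<forall>m\<in>act_line a I qn d g. line_flow a I p (\<lambda>_. 0) u m = 0)"

definition active_indices :: "area_data \<Rightarrow> nat \<Rightarrow> (nat \<Rightarrow> real) \<Rightarrow> (nat \<Rightarrow> real) \<Rightarrow> (nat \<Rightarrow> real)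
    \<Rightarrow> (unit + nat + nat) set" where
  "active_indices a I qn d g = {()} <+> (act_con a g <+> act_line a I qn d g)"

definition constraint_row :: "area_data \<Rightarrow> unit + nat + nat \<Rightarrow> nat \<Rightarrow> real" where
  "constraint_row a s k =
     (case s of Inl _ \<Rightarrow> 1 | Inr (Inl r) \<Rightarrow> Gc a r k | Inr (Inr m) \<Rightarrow> - Am a m k)"

lemma finite_active_indices: "finite (active_indices a I qn d g)"
  by (simp add: active_indices_def finite_act_con finite_act_line)

lemma primal_nondeg_independent_rows:
  assumes "primal_nondeg a I qn d g"
  shows "independent_rows (active_indices a I qn d g) {..<nbus a} (constraint_row a)"
  unfolding independent_rows_def
proof (intro allI impI)
  fix c assume vanish:
    "\<forall>k\<in>{..<nbus a}. (\<Sum>s\<in>active_indices a I qn d g. c s * constraint_row a s k) = 0"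
  have "(\<Sum>s\<in>active_indices a I qn d g. c s * constraint_row a s k)
      = c (Inl ()) + (\<Sum>r\<in>act_con a g. c (Inr (Inl r)) * Gc a r k)
        - (\<Sum>m\<in>act_line a I qn d g. c (Inr (Inr m)) * Am a m k)" for k
    by (simp add: active_indices_def constraint_row_def sum.Plus finite_act_con finite_act_line sum_negf)
  with vanish have "\<forall>k<nbus a. c (Inl ()) + (\<Sum>r\<in>act_con a g. c (Inr (Inl r)) * Gc a r k)
      - (\<Sum>m\<in>act_line a I qn d g. c (Inr (Inr m)) * Am a m k) = 0"
    by simp
  then have "c (Inl ()) = 0" "\<forall>r\<in>act_con a g. c (Inr (Inl r)) = 0"
    "\<forall>m\<in>act_line a I qn d g. c (Inr (Inr m)) = 0"
    using assms[unfolded primal_nondeg_def, THEN spec, of "c (Inl ())", THEN spec,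
        of "\<lambda>r. c (Inr (Inl r))", THEN spec, of "\<lambda>m. c (Inr (Inr m))"]
    by blast+
  then show "\<forall>s\<in>active_indices a I qn d g. c s = 0" by (auto simp: active_indices_def)
qed

lemma primal_nondeg_active_direction:
  assumes "primal_nondeg a I qn d g"
  shows "\<exists>u. active_direction a I qn d g p u"
proof -
  define b where "b s = (case s of Inl _ \<Rightarrow> \<Sum>i\<in>{1..I}. p i | Inr (Inl r) \<Rightarrow> 0
      | Inr (Inr m) \<Rightarrow> - (\<Sum>i\<in>{1..I}. Bm a m i * p i))" for s :: "unit + nat + nat"
  obtain v where v_row: "\<And>s. s \<in> active_indices a I qn d g \<Longrightarrow>
      (\<Sum>k<nbus a. constraint_row a s k * v k) = b s"
    using independent_rows_solvable[OF finite_active_indices finite_lessThan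
        primal_nondeg_independent_rows[OF assms], of b] by blast
  define u where "u k = (if k < nbus a then v k else 0)" for k
  have "(\<Sum>k<nbus a. constraint_row a s k * u k) = b s" if "s \<in> active_indices a I qn d g" for s
    using v_row[OF that] by (simp add: u_def)
  note row = this[unfolded active_indices_def]
  have "imbalance a I p (\<lambda>_. 0) u = 0"
    using row[OF InlI[OF singletonI]] by (simp add: constraint_row_def b_def imbalance_def sum_negf)
  moreover have "gen_lhs a u r = 0" if "r \<in> act_con a g" for r
    using row[OF InrI[OF InlI[OF that]]] by (simp add: constraint_row_def b_def gen_lhs_def)
  moreover have "line_flow a I p (\<lambda>_. 0) u m = 0" if "m \<in> act_line a I qn d g" for m
    using row[OF InrI[OF InrI[OF that]]]
    by (simp add: constraint_row_def b_def line_flow_def sum_negf)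
  ultimately show ?thesis
    unfolding active_direction_def by (intro exI[of _ u]) (simp add: u_def)
qed

lemma eventually_affine_le:
  fixes \<alpha> \<beta> \<gamma> :: real
  assumes "\<alpha> \<le> \<gamma>" "\<alpha> = \<gamma> \<Longrightarrow> \<beta> = 0"
  shows "\<forall>\<^sub>F h in nhds 0. \<alpha> + h * \<beta> \<le> \<gamma>"
proof (cases "\<alpha> = \<gamma>")
  case False
  have "((\<lambda>h. \<alpha> + h * \<beta>) \<longlongrightarrow> \<alpha> + 0 * \<beta>) (nhds 0)"
    by (intro tendsto_intros filterlim_ident)
  then have "\<forall>\<^sub>F h in nhds 0. \<alpha> + h * \<beta> < \<gamma>"
    using assms(1) False by (intro order_tendstoD(2)) auto
  then show ?thesis by eventually_elim simp
qed (use assms in simp)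

lemma active_direction_feas:
  assumes feasible: "g \<in> feas a I qn d" and direction: "active_direction a I qn d g p u"
  shows "\<forall>\<^sub>F h in nhds 0. (\<lambda>k. g k + h * u k) \<in> feas a I (\<lambda>i. qn i + h * p i) d"
proof -
  have "\<forall>\<^sub>F h in nhds 0. \<forall>r\<in>{..<ncon a}. gen_lhs a g r + h * gen_lhs a u r \<le> gb a r"
    using feasible direction
    by (intro eventually_ball_finite ballI eventually_affine_le)
       (auto simp: feas_iff active_direction_def act_con_iff)
  moreover have "\<forall>\<^sub>F h in nhds 0. \<forall>m\<in>{..<nline a}.
      line_flow a I qn d g m + h * line_flow a I p (\<lambda>_. 0) u m \<le> Fv a m"
    using feasible direction
    by (intro eventually_ball_finite ballI eventually_affine_le)
       (auto simp: feas_iff active_direction_def act_line_iff)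
  ultimately show ?thesis
  proof eventually_elim
    case (elim h)
    have "gen_lhs a (\<lambda>k. g k + h * u k) r = gen_lhs a g r + h * gen_lhs a u r" for r
      using gen_lhs_combine[of a 1 g h u r] by simp
    moreover have "imbalance a I (\<lambda>i. qn i + h * p i) d (\<lambda>k. g k + h * u k)
        = imbalance a I qn d g + h * imbalance a I p (\<lambda>_. 0) u"
      using imbalance_combine[of a I 1 qn h p d "\<lambda>_. 0" g u] by simp
    moreover have "line_flow a I (\<lambda>i. qn i + h * p i) d (\<lambda>k. g k + h * u k) m
        = line_flow a I qn d g m + h * line_flow a I p (\<lambda>_. 0) u m" for m
      using line_flow_combine[of a I 1 qn h p d "\<lambda>_. 0" g u m] by simp
    ultimately show ?case
      using elim feasible direction by (simp add: feas_iff active_direction_def)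
  qed
qed

lemma gcost_active_direction:
  assumes "posdef_cost a" "stationary a I qn d g nu lr lm" "active_direction a I qn d g p u"
  shows "gcost a (\<lambda>k. g k + h * u k) = gcost a g
    + h * (\<Sum>i\<in>{1..I}. interface_price a I qn d g nu lm i * p i) + h\<^sup>2 * (quad_form a u / 2)"
  using assms(3) stationary_cost_grad_inner[OF assms(2), of u p]
  by (simp add: gcost_add_scaled[OF assms(1)] active_direction_def)

text \<open>Nearby problems need not have an optimum, where \<^const>\<open>opt_cost\<close> would be meaningless, so both
  estimates concern costs of feasible points.\<close>

definition value_gradient :: "area_data \<Rightarrow> nat \<Rightarrow> (nat \<Rightarrow> real) \<Rightarrow> (nat \<Rightarrow> real)
    \<Rightarrow> (nat \<Rightarrow> real) \<Rightarrow> bool" where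
  "value_gradient a I qn d lam \<longleftrightarrow>
     (\<forall>qn'. \<forall>g\<in>feas a I qn' d. opt_cost a I qn d + (\<Sum>i\<in>{1..I}. lam i * (qn' i - qn i)) \<le> gcost a g)
   \<and> (\<forall>p b. (\<Sum>i\<in>{1..I}. lam i * p i) < b \<longrightarrow>
        (\<forall>\<^sub>F h in at_right 0. \<exists>g\<in>feas a I (\<lambda>i. qn i + h * p i) d.
           gcost a g \<le> opt_cost a I qn d + h * b))"

lemma active_direction_cost_le:
  assumes posdef: "posdef_cost a" and stationary: "stationary a I qn d g nu lr lm"
    and feasible: "g \<in> feas a I qn d" and direction: "active_direction a I qn d g p u"
    and slope: "(\<Sum>i\<in>{1..I}. interface_price a I qn d g nu lm i * p i) < b"
  shows "\<forall>\<^sub>F h in at_right 0. \<exists>g'\<in>feas a I (\<lambda>i. qn i + h * p i) d. gcost a g' \<le> gcost a g + h * b"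
proof -
  let ?slope = "\<Sum>i\<in>{1..I}. interface_price a I qn d g nu lm i * p i"
  have "((\<lambda>h. ?slope + h * (quad_form a u / 2)) \<longlongrightarrow> ?slope + 0 * (quad_form a u / 2)) (at_right 0)"
    by (intro tendsto_intros)
  then have "\<forall>\<^sub>F h in at_right 0. ?slope + h * (quad_form a u / 2) < b"
    using slope by (intro order_tendstoD(2)) auto
  moreover have "\<forall>\<^sub>F h in at_right 0. (\<lambda>k. g k + h * u k) \<in> feas a I (\<lambda>i. qn i + h * p i) d"
    using active_direction_feas[OF feasible direction] by (rule filter_leD[OF at_within_le_nhds])
  ultimately show ?thesis
    using eventually_at_right_less[of 0]
  proof eventually_elim
    case (elim h)
    have "gcost a (\<lambda>k. g k + h * u k) = gcost a g + h * (?slope + h * (quad_form a u / 2))"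
      unfolding gcost_active_direction[OF posdef stationary direction]
      by (simp add: algebra_simps power2_eq_square)
    also have "\<dots> \<le> gcost a g + h * b"
      using elim(1,3) by (intro add_left_mono mult_left_mono) auto
    finally show ?case using elim(2) by blast
  qed
qed

lemma nondegenerate_value_gradient:
  assumes posdef: "posdef_cost a" and nondeg: "nondegenerate a I qn d"
  shows "\<exists>lam. value_gradient a I qn d lam"
proof -
  from nondeg obtain g where optimal: "is_opt a I qn d g"
    and primal: "primal_nondeg a I qn d g" and dual: "dual_nondeg a I qn d g"
    unfolding nondegenerate_def by blast
  have feasible: "g \<in> feas a I qn d" using optimal by (simp add: is_opt_def)
  have opt_cost: "opt_cost a I qn d = gcost a g"
    by (simp add: opt_cost_def gstar_eq[OF posdef optimal])
  obtain nu lr lm where stationary: "stationary a I qn d g nu lr lm"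
    and positive: "\<forall>r\<in>act_con a g. lr r > 0" "\<forall>m\<in>act_line a I qn d g. lm m > 0"
    using dual unfolding dual_nondeg_def stationary_def cost_grad_def by blast
  then have nonneg: "\<forall>r\<in>act_con a g. lr r \<ge> 0" "\<forall>m\<in>act_line a I qn d g. lm m \<ge> 0"
    by (auto intro: less_imp_le)
  have "value_gradient a I qn d (interface_price a I qn d g nu lm)"
    unfolding value_gradient_def opt_cost
  proof (intro conjI allI ballI impI)
    show "gcost a g + (\<Sum>i\<in>{1..I}. interface_price a I qn d g nu lm i * (qn' i - qn i)) \<le> gcost a g'"
      if "g' \<in> feas a I qn' d" for qn' g'
      by (rule interface_price_subgradient[OF posdef stationary nonneg feasible that])
    show "\<forall>\<^sub>F h in at_right 0. \<exists>g'\<in>feas a I (\<lambda>i. qn i + h * p i) d. gcost a g' \<le> gcost a g + h * b"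
      if "(\<Sum>i\<in>{1..I}. interface_price a I qn d g nu lm i * p i) < b" for p b
      using primal_nondeg_active_direction[OF primal, of p]
        active_direction_cost_le[OF posdef stationary feasible _ that] by blast
  qed
  then show ?thesis by blast
qed

subsection \<open>Expected cost of the interchange\<close>

definition outflow_sign :: "nat \<Rightarrow> (nat \<Rightarrow> nat) \<Rightarrow> (nat \<Rightarrow> nat) \<Rightarrow> nat \<Rightarrow> nat \<Rightarrow> real" where
  "outflow_sign I orig dest n i = (if i \<in> {1..I} \<and> orig i = n then 1
     else if i \<in> {1..I} \<and> dest i = n then - 1 else 0)"

lemma qloc_eq: "qloc I orig dest q n = (\<lambda>i. outflow_sign I orig dest n i * q i)"
  by (auto simp: qloc_def outflow_sign_def fun_eq_iff)

lemma qloc_cong: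
  assumes "\<And>i. i \<in> {1..I} \<Longrightarrow> x i = y i"
  shows "qloc I orig dest x n = qloc I orig dest y n"
  using assms by (auto simp: qloc_def fun_eq_iff)

lemma qloc_mix: "qloc I orig dest (mix t x y) n = mix t (qloc I orig dest x n) (qloc I orig dest y n)"
  by (simp add: qloc_eq mix_def fun_eq_iff algebra_simps)

locale interchange =
  fixes N I :: nat
    and orig dest :: "nat \<Rightarrow> nat"
    and Q :: "nat \<Rightarrow> real"
    and ar :: "nat \<Rightarrow> area_data"
    and F :: "nat \<Rightarrow> (nat \<Rightarrow> real) measure"
  assumes orig_in: "i \<in> {1..I} \<Longrightarrow> orig i \<in> {1..N}"
    and posdef: "n \<in> {1..N} \<Longrightarrow> posdef_cost (ar n)"
    and F_prob: "n \<in> {1..N} \<Longrightarrow> prob_space (F n)"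
    and AE_nondegenerate: "n \<in> {1..N} \<Longrightarrow> q \<in> Pi {1..I} (\<lambda>i. {..Q i}) \<Longrightarrow>
        AE d in F n. nondegenerate (ar n) I (qloc I orig dest q n) d"
    and integrable_opt_cost: "n \<in> {1..N} \<Longrightarrow> q \<in> Pi {1..I} (\<lambda>i. {..Q i}) \<Longrightarrow>
        integrable (F n) (opt_cost (ar n) I (qloc I orig dest q n))"
begin

abbreviation within_capacity :: "(nat \<Rightarrow> real) set" where
  "within_capacity \<equiv> Pi {1..I} (\<lambda>i. {..Q i})"

abbreviation loc :: "(nat \<Rightarrow> real) \<Rightarrow> nat \<Rightarrow> nat \<Rightarrow> real" where
  "loc q n \<equiv> qloc I orig dest q n"

abbreviation regular :: "nat \<Rightarrow> (nat \<Rightarrow> real) \<Rightarrow> (nat \<Rightarrow> real) \<Rightarrow> bool" where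
  "regular n q d \<equiv> nondegenerate (ar n) I (loc q n) d"

abbreviation area_cost :: "nat \<Rightarrow> (nat \<Rightarrow> real) \<Rightarrow> (nat \<Rightarrow> real) \<Rightarrow> real" where
  "area_cost n q \<equiv> opt_cost (ar n) I (loc q n)"

abbreviation total_cost :: "(nat \<Rightarrow> real) \<Rightarrow> real" where
  "total_cost \<equiv> Cbar N I orig dest ar F"

lemma total_cost_eq: "total_cost q = (\<Sum>n\<in>{1..N}. integral\<^sup>L (F n) (area_cost n q))"
  by (simp add: Cbar_def opt_cost_def[abs_def])

lemma total_cost_cong: "(\<And>i. i \<in> {1..I} \<Longrightarrow> x i = y i) \<Longrightarrow> total_cost x = total_cost y"
  using qloc_cong[of I x y] by (simp add: Cbar_def)

lemma mix_within_capacity: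
  "x \<in> within_capacity \<Longrightarrow> y \<in> within_capacity \<Longrightarrow> t \<in> {0..1} \<Longrightarrow> mix t x y \<in> within_capacity"
  by (rule mix_in_Pi) auto

lemma coordinate_step_within_capacity:
  "x \<in> within_capacity \<Longrightarrow> y \<in> within_capacity \<Longrightarrow> h \<in> {0..1} \<Longrightarrow>
    coordinate_step h x y i \<in> within_capacity"
  by (rule coordinate_step_in_Pi) auto

lemma AE_area_cost_mix_le:
  assumes "n \<in> {1..N}" "x \<in> within_capacity" "y \<in> within_capacity" "t \<in> {0..1}"
  shows "AE d in F n. area_cost n (mix t x y) d \<le> (1 - t) * area_cost n x d + t * area_cost n y d"
  using AE_nondegenerate[OF assms(1,2)] AE_nondegenerate[OF assms(1,3)]
    AE_nondegenerate[OF assms(1) mix_within_capacity[OF assms(2-4)]]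
proof eventually_elim
  case (elim d)
  then show ?case
    unfolding qloc_mix by (intro opt_cost_mix_le posdef assms)
qed

lemma mix_convex_on_total_cost: "mix_convex_on within_capacity total_cost"
  unfolding mix_convex_on_def
proof (intro ballI)
  fix x y t assume args_in: "x \<in> within_capacity" "y \<in> within_capacity" "t \<in> {0..1::real}"
  have "integral\<^sup>L (F n) (area_cost n (mix t x y))
      \<le> (1 - t) * integral\<^sup>L (F n) (area_cost n x) + t * integral\<^sup>L (F n) (area_cost n y)"
    if area: "n \<in> {1..N}" for n
  proof -
    note integrable_area = integrable_opt_cost[OF area]
    have "integral\<^sup>L (F n) (area_cost n (mix t x y))
        \<le> (\<integral>d. (1 - t) * area_cost n x d + t * area_cost n y d \<partial>F n)"
      by (intro integral_mono_AE AE_area_cost_mix_le area args_in integrable_area mix_within_capacity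
          Bochner_Integration.integrable_add integrable_mult_right)
    also have "\<dots> = (1 - t) * integral\<^sup>L (F n) (area_cost n x) + t * integral\<^sup>L (F n) (area_cost n y)"
      using integrable_area args_in by simp
    finally show ?thesis .
  qed
  then show "total_cost (mix t x y) \<le> (1 - t) * total_cost x + t * total_cost y"
    unfolding total_cost_eq sum_distrib_left sum.distrib[symmetric] by (intro sum_mono)
qed

lemma area_cost_ge_linear:
  assumes area: "n \<in> {1..N}" and gradient: "value_gradient (ar n) I (loc x n) d lam"
    and "regular n y d"
  shows "area_cost n x d + (\<Sum>i\<in>{1..I}. lam i * outflow_sign I orig dest n i * (y i - x i))
    \<le> area_cost n y d"
proof -
  have "area_cost n x d + (\<Sum>i\<in>{1..I}. lam i * (loc y n i - loc x n i)) \<le> area_cost n y d"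
    using gradient nondegenerate_gstar_feas[OF posdef[OF area] assms(3)]
    unfolding value_gradient_def opt_cost_def[of _ _ "loc y n"] by blast
  then show ?thesis by (simp add: qloc_eq right_diff_distrib mult.assoc)
qed

lemma area_cost_le_linear:
  assumes area: "n \<in> {1..N}" and i_in: "i \<in> {1..I}"
    and gradient: "value_gradient (ar n) I (loc x n) d lam"
    and slope: "lam i * outflow_sign I orig dest n i * s < b"
  shows "\<forall>\<^sub>F h in at_right 0. regular n (x(i := x i + h * s)) d \<longrightarrow>
    area_cost n (x(i := x i + h * s)) d \<le> area_cost n x d + h * b"
proof -
  define p where "p j = (if j = i then outflow_sign I orig dest n i * s else 0)" for j
  have "(\<Sum>j\<in>{1..I}. lam j * p j)
      = (\<Sum>j\<in>{1..I}. if j = i then lam i * outflow_sign I orig dest n i * s else 0)"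
    by (intro sum.cong) (auto simp: p_def)
  with slope i_in have "(\<Sum>j\<in>{1..I}. lam j * p j) < b" by simp
  then have "\<forall>\<^sub>F h in at_right 0. \<exists>g\<in>feas (ar n) I (\<lambda>j. loc x n j + h * p j) d.
      gcost (ar n) g \<le> area_cost n x d + h * b"
    using gradient by (simp add: value_gradient_def)
  then show ?thesis
  proof eventually_elim
    case (elim h)
    have "loc (x(i := x i + h * s)) n = (\<lambda>j. loc x n j + h * p j)"
      by (auto simp: qloc_eq p_def fun_eq_iff algebra_simps)
    with elim show ?case by (auto intro: order_trans[OF opt_cost_le[OF posdef[OF area]]])
  qed
qed

subsection \<open>Coordinatewise minima of the expected cost\<close>

lemma le_liminf_area_coordinate_quotient:
  assumes area: "n \<in> {1..N}" and regular: "regular n x d" "regular n y d"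
    and regular_step: "\<forall>m. \<forall>i\<in>{1..I}. regular n (coordinate_step (harmonic m) x y i) d"
  shows "le_liminf (area_cost n x d - area_cost n y d)
    (\<lambda>m. - coordinate_quotient {1..I} (\<lambda>q. area_cost n q d) x y (harmonic m))"
proof -
  obtain lam where gradient: "value_gradient (ar n) I (loc x n) d lam"
    using nondegenerate_value_gradient[OF posdef[OF area] regular(1)] by blast
  define \<mu> where "\<mu> i = lam i * outflow_sign I orig dest n i" for i
  define quot where "quot i h = (area_cost n (coordinate_step h x y i) d - area_cost n x d) / h" for i h
  have "le_liminf (- (\<mu> i * (y i - x i))) (\<lambda>m. - quot i (harmonic m))" if i_in: "i \<in> {1..I}" for i
    unfolding le_liminf_def
  proof (intro allI impI)
    fix a assume "a < - (\<mu> i * (y i - x i))"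
    then obtain b where b_between: "\<mu> i * (y i - x i) < b" "b < - a"
      using dense[of "\<mu> i * (y i - x i)" "- a"] by auto
    have "\<forall>\<^sub>F h in at_right 0. regular n (coordinate_step h x y i) d \<longrightarrow>
        area_cost n (coordinate_step h x y i) d \<le> area_cost n x d + h * b"
      using area_cost_le_linear[OF area i_in gradient] b_between(1)
      unfolding \<mu>_def coordinate_step_def by blast
    from eventually_compose_filterlim[OF this filterlim_harmonic]
    show "\<forall>\<^sub>F m in sequentially. a < - quot i (harmonic m)"
    proof eventually_elim
      case (elim m)
      then have "quot i (harmonic m) \<le> b"
        using regular_step i_in harmonic_pos unfolding quot_def
        by (simp add: pos_divide_le_eq mult.commute)
      with b_between(2) show ?case by simp
    qed
  qed
  then have "le_liminf (\<Sum>i\<in>{1..I}. - (\<mu> i * (y i - x i))) (\<lambda>m. \<Sum>i\<in>{1..I}. - quot i (harmonic m))"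
    by (rule le_liminf_sum)
  then show ?thesis
  proof (rule le_liminf_mono)
    show "area_cost n x d - area_cost n y d \<le> (\<Sum>i\<in>{1..I}. - (\<mu> i * (y i - x i)))"
      using area_cost_ge_linear[OF area gradient regular(2)] by (simp add: \<mu>_def sum_negf)
  qed (simp add: coordinate_quotient_def quot_def sum_negf)
qed

lemma AE_area_coordinate_quotient_le:
  assumes area: "n \<in> {1..N}" and args_in: "x \<in> within_capacity" "y \<in> within_capacity"
    and h_bounds: "0 < h" "h \<le> 1"
  shows "AE d in F n. coordinate_quotient {1..I} (\<lambda>q. area_cost n q d) x y h
    \<le> coordinate_quotient {1..I} (\<lambda>q. area_cost n q d) x y 1"
proof -
  have "AE d in F n. \<forall>i\<in>{1..I}. area_cost n (coordinate_step h x y i) d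
      \<le> (1 - h) * area_cost n x d + h * area_cost n (coordinate_step 1 x y i) d"
    unfolding coordinate_step_eq_mix[of h] coordinate_step_1[symmetric]
    using h_bounds
    by (intro AE_finite_allI AE_area_cost_mix_le area args_in coordinate_step_within_capacity) auto
  then show ?thesis
  proof eventually_elim
    case (elim d)
    then show ?case
      using h_bounds unfolding coordinate_quotient_def by (intro sum_mono) (simp add: field_simps)
  qed
qed

lemma area_coordinate_quotient_integral:
  assumes "n \<in> {1..N}" "x \<in> within_capacity" "y \<in> within_capacity" "h \<in> {0..1}"
  shows "integrable (F n) (\<lambda>d. coordinate_quotient {1..I} (\<lambda>q. area_cost n q d) x y h)"
    and "(\<integral>d. coordinate_quotient {1..I} (\<lambda>q. area_cost n q d) x y h \<partial>F n)
      = coordinate_quotient {1..I} (\<lambda>q. integral\<^sup>L (F n) (area_cost n q)) x y h"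
  by (intro integral_coordinate_quotient integrable_opt_cost coordinate_step_within_capacity assms)+

lemma le_liminf_expected_area_coordinate_quotient:
  assumes area: "n \<in> {1..N}" and x_in: "x \<in> within_capacity" and y_in: "y \<in> within_capacity"
  shows "le_liminf (integral\<^sup>L (F n) (area_cost n x) - integral\<^sup>L (F n) (area_cost n y))
    (\<lambda>m. - coordinate_quotient {1..I} (\<lambda>q. integral\<^sup>L (F n) (area_cost n q)) x y (harmonic m))"
proof -
  let ?quot = "\<lambda>h d. coordinate_quotient {1..I} (\<lambda>q. area_cost n q d) x y h"
  have "le_liminf (\<integral>d. area_cost n x d - area_cost n y d \<partial>F n)
      (\<lambda>m. \<integral>d. - ?quot (harmonic m) d \<partial>F n)"
  proof (rule le_liminf_integral)
    show "integrable (F n) (\<lambda>d. - ?quot (harmonic m) d)" for m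
      using area_coordinate_quotient_integral(1)[OF area x_in y_in harmonic_in] by simp
    show "integrable (F n) (\<lambda>d. area_cost n x d - area_cost n y d)"
      using integrable_opt_cost[OF area] x_in y_in by simp
    show "integrable (F n) (\<lambda>d. - ?quot 1 d)"
      using area_coordinate_quotient_integral(1)[OF area x_in y_in, of 1] by simp
    show "AE d in F n. - ?quot 1 d \<le> - ?quot (harmonic m) d" for m
      using AE_area_coordinate_quotient_le[OF area x_in y_in harmonic_pos] harmonic_in by simp
    have "AE d in F n. \<forall>m. \<forall>i\<in>{1..I}. regular n (coordinate_step (harmonic m) x y i) d"
      unfolding AE_all_countable
      by (intro allI AE_finite_allI AE_nondegenerate area coordinate_step_within_capacity
          x_in y_in harmonic_in) auto
    with AE_nondegenerate[OF area x_in] AE_nondegenerate[OF area y_in]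
    show "AE d in F n. le_liminf (area_cost n x d - area_cost n y d) (\<lambda>m. - ?quot (harmonic m) d)"
      by eventually_elim (rule le_liminf_area_coordinate_quotient[OF area])
  qed
  then show ?thesis
    using integrable_opt_cost[OF area] x_in y_in
    unfolding area_coordinate_quotient_integral(2)[OF area x_in y_in harmonic_in, symmetric] by simp
qed

lemma le_liminf_total_coordinate_quotient:
  assumes "x \<in> within_capacity" "y \<in> within_capacity"
  shows "le_liminf (total_cost x - total_cost y)
    (\<lambda>m. - coordinate_quotient {1..I} total_cost x y (harmonic m))"
  unfolding total_cost_eq[abs_def] coordinate_quotient_sum sum_subtractf[symmetric] sum_negf[symmetric]
  by (intro le_liminf_sum le_liminf_expected_area_coordinate_quotient assms)

lemma total_cost_coordinatewise_min:
  assumes x_in: "x \<in> within_capacity" and y_in: "y \<in> within_capacity"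
    and min_coordinate: "\<And>i z. i \<in> {1..I} \<Longrightarrow> y i \<noteq> x i \<Longrightarrow> z \<in> {..Q i} \<Longrightarrow>
      total_cost x \<le> total_cost (x(i := z))"
  shows "total_cost x \<le> total_cost y"
proof -
  have "total_cost x \<le> total_cost (coordinate_step (harmonic m) x y i)" if i_in: "i \<in> {1..I}" for i m
  proof (cases "y i = x i")
    case False
    have "coordinate_step (harmonic m) x y i \<in> within_capacity"
      by (rule coordinate_step_within_capacity[OF x_in y_in harmonic_in])
    then have "coordinate_step (harmonic m) x y i i \<in> {..Q i}" using i_in by (auto simp: Pi_iff)
    then show ?thesis using min_coordinate[OF i_in False] by (simp add: coordinate_step_def)
  qed (simp add: coordinate_step_def)
  then have "0 \<le> coordinate_quotient {1..I} total_cost x y (harmonic m)" for m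
    unfolding coordinate_quotient_def by (intro sum_nonneg divide_nonneg_pos harmonic_pos) simp
  then have "- coordinate_quotient {1..I} total_cost x y (harmonic m) \<le> 0" for m by simp
  then have "total_cost x - total_cost y \<le> 0"
    by (rule le_liminf_bounded[OF le_liminf_total_coordinate_quotient[OF x_in y_in]])
  then show ?thesis by simp
qed

subsection \<open>Continuity and coercivity of the expected cost\<close>

lemma exists_coercivity_constant:
  "\<exists>c\<ge>0. \<forall>n\<in>{1..N}. \<forall>g. \<bar>\<Sum>k<nbus (ar n). g k\<bar> - c \<le> gcost (ar n) g"
proof -
  obtain c where coercive: "\<And>n. n \<in> {1..N} \<Longrightarrow> 0 \<le> c n"
      "\<And>n g. n \<in> {1..N} \<Longrightarrow> \<bar>\<Sum>k<nbus (ar n). g k\<bar> - c n \<le> gcost (ar n) g"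
    using gcost_coercive[OF posdef] by metis
  have "c n \<le> (\<Sum>n\<in>{1..N}. c n)" if "n \<in> {1..N}" for n
    by (intro member_le_sum coercive that) auto
  then have "\<bar>\<Sum>k<nbus (ar n). g k\<bar> - (\<Sum>n\<in>{1..N}. c n) \<le> gcost (ar n) g" if "n \<in> {1..N}" for n g
    using coercive(2)[OF that, of g] that by fastforce
  then show ?thesis using coercive(1) by (intro exI[of _ "\<Sum>n\<in>{1..N}. c n"]) (auto intro: sum_nonneg)
qed

lemma neg_coercivity_constant_le_area_cost:
  assumes "\<And>g. \<bar>\<Sum>k<nbus (ar n). g k\<bar> - c \<le> gcost (ar n) g"
  shows "- c \<le> area_cost n q d"
  using assms[of "gstar (ar n) I (loc q n) d"] unfolding opt_cost_def by linarith

lemma le_liminf_area_cost: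
  assumes area: "n \<in> {1..N}" and lim: "converges_on {1..I} X x"
    and regular: "regular n x d" "\<forall>k. regular n (X k) d"
  shows "le_liminf (area_cost n x d) (\<lambda>k. area_cost n (X k) d)"
proof -
  obtain lam where gradient: "value_gradient (ar n) I (loc x n) d lam"
    using nondegenerate_value_gradient[OF posdef[OF area] regular(1)] by blast
  define minorant where
    "minorant z = area_cost n x d + (\<Sum>i\<in>{1..I}. lam i * outflow_sign I orig dest n i * (z i - x i))" for z
  have "(\<lambda>k. minorant (X k)) \<longlonglongrightarrow> minorant x"
    unfolding minorant_def using lim by (intro tendsto_intros) (auto simp: converges_on_def)
  then have "le_liminf (minorant x) (\<lambda>k. minorant (X k))" by (rule tendsto_le_liminf)
  then show ?thesis
  proof (rule le_liminf_mono)
    show "\<forall>\<^sub>F k in sequentially. minorant (X k) \<le> area_cost n (X k) d"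
      using area_cost_ge_linear[OF area gradient] regular(2) by (simp add: minorant_def)
  qed (simp add: minorant_def)
qed

lemma le_liminf_total_cost:
  assumes seq_in: "\<And>k. X k \<in> within_capacity" and x_in: "x \<in> within_capacity"
    and lim: "converges_on {1..I} X x"
  shows "le_liminf (total_cost x) (\<lambda>k. total_cost (X k))"
  unfolding total_cost_eq
proof (rule le_liminf_sum)
  fix n assume area: "n \<in> {1..N}"
  interpret prob_space "F n" by (rule F_prob[OF area])
  obtain c where coercive: "\<And>g. \<bar>\<Sum>k<nbus (ar n). g k\<bar> - c \<le> gcost (ar n) g"
    using exists_coercivity_constant area by blast
  show "le_liminf (integral\<^sup>L (F n) (area_cost n x)) (\<lambda>k. integral\<^sup>L (F n) (area_cost n (X k)))"
  proof (rule le_liminf_integral)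
    show "AE d in F n. - c \<le> area_cost n (X k) d" for k
      using neg_coercivity_constant_le_area_cost[OF coercive] by simp
    have "AE d in F n. \<forall>k. regular n (X k) d"
      unfolding AE_all_countable by (intro allI AE_nondegenerate area seq_in)
    with AE_nondegenerate[OF area x_in]
    show "AE d in F n. le_liminf (area_cost n x d) (\<lambda>k. area_cost n (X k) d)"
      by eventually_elim (rule le_liminf_area_cost[OF area lim])
  qed (use integrable_opt_cost[OF area] seq_in x_in in auto)
qed

lemma total_cost_continuous:
  assumes seq_in: "\<And>k. X k \<in> within_capacity" and lim: "converges_on {1..I} X x"
  shows "(\<lambda>k. total_cost (X k)) \<longlonglongrightarrow> total_cost x"
proof -
  have x_in: "x \<in> within_capacity" by (rule converges_on_Pi_closed[OF lim seq_in]) simp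
  show ?thesis
  proof (rule order_tendstoI)
    show "\<forall>\<^sub>F k in sequentially. a < total_cost (X k)" if "a < total_cost x" for a
      using le_liminf_total_cost[OF seq_in x_in lim] that by (simp add: le_liminf_def)
    show "\<forall>\<^sub>F k in sequentially. total_cost (X k) < a" if "total_cost x < a" for a
      by (rule mix_convex_on_orthant_usc[OF _ mix_convex_on_total_cost total_cost_cong
            seq_in x_in lim that]) auto
  qed
qed

lemma net_export_upd:
  assumes "i \<in> {1..I}"
  shows "(\<Sum>j\<in>{1..I}. loc (x(i := z)) (orig i) j) = (\<Sum>j\<in>{1..I}. loc x (orig i) j) + (z - x i)"
proof -
  have "(\<Sum>j\<in>{1..I}. loc (x(i := z)) (orig i) j)
      = (\<Sum>j\<in>{1..I}. loc x (orig i) j + (if j = i then z - x i else 0))"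
    by (rule sum.cong) (auto simp: qloc_def)
  then show ?thesis using assms by (simp add: sum.distrib)
qed

lemma net_export_change_le_area_costs:
  assumes area: "n \<in> {1..N}" and regular: "regular n x d" "regular n y d"
    and coercive: "\<And>g. \<bar>\<Sum>k<nbus (ar n). g k\<bar> - c \<le> gcost (ar n) g"
  shows "\<bar>(\<Sum>j\<in>{1..I}. loc y n j) - (\<Sum>j\<in>{1..I}. loc x n j)\<bar>
    \<le> area_cost n x d + area_cost n y d + 2 * c"
proof -
  have balance: "(\<Sum>k<nbus (ar n). gstar (ar n) I (loc q n) d k)
      = (\<Sum>k<nbus (ar n). d k) + (\<Sum>j\<in>{1..I}. loc q n j)"
    if "regular n q d" for q
    using nondegenerate_gstar_feas[OF posdef[OF area] that]
    by (simp add: feas_iff imbalance_def sum_subtractf)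
  show ?thesis
    using coercive[of "gstar (ar n) I (loc x n) d"] coercive[of "gstar (ar n) I (loc y n) d"]
    unfolding balance[OF regular(1)] balance[OF regular(2)] opt_cost_def by linarith
qed

lemma expected_area_cost_le:
  fixes c l :: real
  assumes area: "n \<in> {1..N}" and q_level: "q \<in> within_capacity" "total_cost q \<le> l"
    and c_bound: "0 \<le> c" "\<forall>n\<in>{1..N}. \<forall>q d. - c \<le> area_cost n q d"
  shows "integral\<^sup>L (F n) (area_cost n q) \<le> l + real N * c"
proof -
  have expected_ge: "- c \<le> integral\<^sup>L (F m) (area_cost m q)" if m_area: "m \<in> {1..N}" for m
  proof -
    interpret prob_space "F m" by (rule F_prob[OF m_area])
    show ?thesis
      using c_bound(2) m_area
      by (intro integral_ge_const integrable_opt_cost m_area q_level(1)) auto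
  qed
  have "integral\<^sup>L (F n) (area_cost n q) + c \<le> (\<Sum>m\<in>{1..N}. integral\<^sup>L (F m) (area_cost m q) + c)"
    using expected_ge area by (intro member_le_sum) fastforce+
  also have "\<dots> = total_cost q + real N * c" by (simp add: total_cost_eq sum.distrib)
  finally show ?thesis using q_level(2) c_bound(1) by linarith
qed

text \<open>A sublevel set need not be bounded, but a single step changes the net export of the origin of the
  interface by the step length, and generation balances that export.\<close>

lemma total_cost_step_bounded:
  "\<exists>R. \<forall>x\<in>within_capacity. \<forall>i\<in>{1..I}. \<forall>z\<in>{..Q i}.
     total_cost x \<le> l \<longrightarrow> total_cost (x(i := z)) \<le> l \<longrightarrow> dist z (x i) \<le> R"
proof -
  obtain c where coercive: "0 \<le> c" "\<And>n g. n \<in> {1..N} \<Longrightarrow> \<bar>\<Sum>k<nbus (ar n). g k\<bar> - c \<le> gcost (ar n) g"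
    using exists_coercivity_constant by blast
  have area_cost_ge: "\<forall>n\<in>{1..N}. \<forall>q d. - c \<le> area_cost n q d"
    using neg_coercivity_constant_le_area_cost coercive(2) by blast
  have "dist z (x i) \<le> 2 * (l + real N * c) + 2 * c"
    if x_in: "x \<in> within_capacity" and i_in: "i \<in> {1..I}" and z_in: "z \<in> {..Q i}"
      and level: "total_cost x \<le> l" "total_cost (x(i := z)) \<le> l" for x i z
  proof -
    let ?n = "orig i" and ?y = "x(i := z)"
    have area: "?n \<in> {1..N}" by (rule orig_in[OF i_in])
    have y_in: "?y \<in> within_capacity" using x_in z_in by (auto simp: Pi_iff)
    interpret prob_space "F ?n" by (rule F_prob[OF area])
    have "AE d in F ?n. \<bar>z - x i\<bar> - 2 * c \<le> area_cost ?n x d + area_cost ?n ?y d"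
      using AE_nondegenerate[OF area x_in] AE_nondegenerate[OF area y_in]
    proof eventually_elim
      case (elim d)
      from net_export_change_le_area_costs[OF area this coercive(2)[OF area]] show ?case
        unfolding net_export_upd[OF i_in] by simp
    qed
    then have "\<bar>z - x i\<bar> - 2 * c \<le> (\<integral>d. area_cost ?n x d + area_cost ?n ?y d \<partial>F ?n)"
      by (intro integral_ge_const Bochner_Integration.integrable_add integrable_opt_cost area x_in y_in)
    also have "\<dots> = integral\<^sup>L (F ?n) (area_cost ?n x) + integral\<^sup>L (F ?n) (area_cost ?n ?y)"
      by (intro Bochner_Integration.integral_add integrable_opt_cost area x_in y_in)
    also have "\<dots> \<le> (l + real N * c) + (l + real N * c)"
      by (intro add_mono expected_area_cost_le area x_in y_in level coercive area_cost_ge)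
    finally show ?thesis by (simp add: dist_real_def algebra_simps)
  qed
  then show ?thesis by blast
qed

end

subsection \<open>Asynchronous scheduling\<close>

locale interchange_schedule = interchange N I orig dest Q ar F
  for N I :: nat
    and orig dest :: "nat \<Rightarrow> nat"
    and Q :: "nat \<Rightarrow> real"
    and ar :: "nat \<Rightarrow> area_data"
    and F :: "nat \<Rightarrow> (nat \<Rightarrow> real) measure" +
  fixes M :: "'w measure"
    and D :: "nat \<Rightarrow> nat \<Rightarrow> 'w \<Rightarrow> (nat \<Rightarrow> real)"
    and qs :: "nat \<Rightarrow> nat \<Rightarrow> real"
  assumes load_measurable: "n \<in> {1..N} \<Longrightarrow> D n (Suc t) \<in> borel_measurable M"
    and load_distr: "n \<in> {1..N} \<Longrightarrow> distr M borel (D n (Suc t)) = F n"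
    and schedule_init: "qs 0 \<in> Pi {1..I} (\<lambda>i. {..Q i})"
    and schedule_keep: "j \<in> {1..I} \<Longrightarrow> j \<noteq> t mod I + 1 \<Longrightarrow> qs (Suc t) j = qs t j"
    and schedule_cap: "qs (Suc t) (t mod I + 1) \<le> Q (t mod I + 1)"
    and schedule_min: "z \<le> Q (t mod I + 1) \<Longrightarrow>
        (\<Sum>n\<in>{1..N}. \<integral>w. opt_cost (ar n) I
            (qloc I orig dest ((qs t)(t mod I + 1 := qs (Suc t) (t mod I + 1))) n)
            (D n (Suc t) w) \<partial>M)
        \<le> (\<Sum>n\<in>{1..N}. \<integral>w. opt_cost (ar n) I
            (qloc I orig dest ((qs t)(t mod I + 1 := z)) n) (D n (Suc t) w) \<partial>M)"
begin

lemma sampled_cost_eq_total_cost: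
  assumes q_in: "q \<in> within_capacity"
  shows "(\<Sum>n\<in>{1..N}. \<integral>w. area_cost n q (D n (Suc t) w) \<partial>M) = total_cost q"
  unfolding total_cost_eq
proof (rule sum.cong[OF refl])
  fix n assume area: "n \<in> {1..N}"
  have "area_cost n q \<in> borel_measurable borel"
    using borel_measurable_integrable[OF integrable_opt_cost[OF area q_in]]
    unfolding load_distr[OF area, of t, symmetric] by simp
  then show "(\<integral>w. area_cost n q (D n (Suc t) w) \<partial>M) = integral\<^sup>L (F n) (area_cost n q)"
    unfolding load_distr[OF area, of t, symmetric] using load_measurable[OF area]
    by (subst integral_distr) auto
qed

lemma schedule_within_capacity: "qs t \<in> within_capacity"
proof (induction t)
  case 0
  then show ?case by (rule schedule_init)
next
  case (Suc t)
  have "qs (Suc t) i \<le> Q i" if "i \<in> {1..I}" for i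
    using schedule_keep[OF that] schedule_cap[of t] Suc that
    by (cases "i = t mod I + 1") (auto simp: Pi_iff)
  then show ?case by (simp add: Pi_iff)
qed

lemma schedule_minimizes:
  assumes z_in: "z \<in> {..Q (t mod I + 1)}"
  shows "total_cost (qs (Suc t)) \<le> total_cost ((qs t)(t mod I + 1 := z))"
proof -
  let ?i = "t mod I + 1"
  have z_cap: "z \<le> Q ?i" using z_in by simp
  have update_in: "(qs t)(?i := y) \<in> within_capacity" if "y \<le> Q ?i" for y
    using schedule_within_capacity[of t] that by (auto simp: Pi_iff)
  have "total_cost (qs (Suc t)) = total_cost ((qs t)(?i := qs (Suc t) ?i))"
    by (rule total_cost_cong) (simp add: schedule_keep)
  also have "\<dots> \<le> total_cost ((qs t)(?i := z))"
    using schedule_min[OF z_cap]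
    unfolding sampled_cost_eq_total_cost[OF update_in[OF schedule_cap]]
      sampled_cost_eq_total_cost[OF update_in[OF z_cap]] .
  finally show ?thesis .
qed

theorem schedule_limit_point_optimal:
  assumes "strict_mono \<sigma>" and lim: "converges_on {1..I} (\<lambda>k. qs (\<sigma> k)) p"
    and q_in: "q \<in> within_capacity"
  shows "p \<in> within_capacity" and "total_cost p \<le> total_cost q"
proof -
  show "p \<in> within_capacity"
    by (rule converges_on_Pi_closed[OF lim schedule_within_capacity]) simp
  show "total_cost p \<le> total_cost q"
  proof (cases "I = 0")
    case True
    then show ?thesis by (intro eq_refl total_cost_cong) simp
  next
    case False
    interpret cyclic_block_descent I "\<lambda>i. {..Q i}" total_cost qs
      using False
      by (intro cyclic_block_descent.intro[OF _ closed_atMost total_cost_cong total_cost_continuous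
            total_cost_coordinatewise_min total_cost_step_bounded schedule_within_capacity
            schedule_keep schedule_minimizes]) simp
    show ?thesis by (rule limit_point_minimal[OF assms])
  qed
qed

end

theorem theorem3:
  fixes N I :: nat
    and orig dest :: "nat \<Rightarrow> nat"
    and Q :: "nat \<Rightarrow> real"
    and ar :: "nat \<Rightarrow> area_data"
    and F :: "nat \<Rightarrow> (nat \<Rightarrow> real) measure"
    and M :: "'w measure"
    and D :: "nat \<Rightarrow> nat \<Rightarrow> 'w \<Rightarrow> (nat \<Rightarrow> real)"
    and qs :: "nat \<Rightarrow> nat \<Rightarrow> real"
    and qt :: "nat \<Rightarrow> real"
  assumes interfaces: "\<forall>i\<in>{1..I}. orig i \<in> {1..N} \<and> dest i \<in> {1..N} \<and> orig i \<noteq> dest i"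
    and H_posdef: "\<forall>n\<in>{1..N}.
        (\<forall>j<nbus (ar n). \<forall>k<nbus (ar n). Hm (ar n) j k = Hm (ar n) k j)
        \<and> (\<forall>v::nat\<Rightarrow>real. (\<exists>k<nbus (ar n). v k \<noteq> 0) \<longrightarrow>
              (\<Sum>j<nbus (ar n). \<Sum>k<nbus (ar n). v j * Hm (ar n) j k * v k) > 0)"
    and F_prob: "\<forall>n\<in>{1..N}. prob_space (F n) \<and> sets (F n) = sets borel"
    and feas_nondeg: "\<forall>n\<in>{1..N}. \<forall>q. (\<forall>i\<in>{1..I}. q i \<le> Q i) \<longrightarrow>
        (AE d in F n. feas (ar n) I (qloc I orig dest q n) d \<noteq> {}
                      \<and> nondegenerate (ar n) I (qloc I orig dest q n) d)"
    and Cbar_finite: "\<forall>n\<in>{1..N}. \<forall>q. (\<forall>i\<in>{1..I}. q i \<le> Q i) \<longrightarrow>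
        integrable (F n) (\<lambda>d. gcost (ar n) (gstar (ar n) I (qloc I orig dest q n) d))"
    and M_prob: "prob_space M"
    and iid: "\<forall>n\<in>{1..N}. prob_space.indep_vars M (\<lambda>_. borel) (D n) {1..}
        \<and> (\<forall>t\<ge>1. distr M borel (D n t) = F n)"
    and init: "\<forall>i\<in>{1..I}. qs 0 i \<le> Q i"
    and update: "\<forall>t\<ge>1.
        (\<forall>j\<in>{1..I}. j \<noteq> (t - 1) mod I + 1 \<longrightarrow> qs t j = qs (t - 1) j)
        \<and> qs t ((t - 1) mod I + 1) \<le> Q ((t - 1) mod I + 1)
        \<and> (\<forall>x. x \<le> Q ((t - 1) mod I + 1) \<longrightarrow>
             (\<Sum>n\<in>{1..N}. integral\<^sup>L M (\<lambda>w. gcost (ar n) (gstar (ar n) I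
                 (qloc I orig dest ((qs (t - 1))((t - 1) mod I + 1 := qs t ((t - 1) mod I + 1))) n)
                 (D n t w))))
             \<le> (\<Sum>n\<in>{1..N}. integral\<^sup>L M (\<lambda>w. gcost (ar n) (gstar (ar n) I
                 (qloc I orig dest ((qs (t - 1))((t - 1) mod I + 1 := x)) n)
                 (D n t w)))))"
    and limit_point: "\<exists>\<sigma>::nat\<Rightarrow>nat. strict_mono \<sigma> \<and>
        (\<forall>i\<in>{1..I}. (\<lambda>k. qs (\<sigma> k) i) \<longlonglongrightarrow> qt i)"
  shows "(\<forall>i\<in>{1..I}. qt i \<le> Q i) \<and>
         (\<forall>q. (\<forall>i\<in>{1..I}. q i \<le> Q i) \<longrightarrow> Cbar N I orig dest ar F qt \<le> Cbar N I orig dest ar F q)"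
proof -
  interpret interchange_schedule N I orig dest Q ar F M D qs
  proof (intro interchange_schedule.intro interchange.intro interchange_schedule_axioms.intro)
    fix n t assume area: "n \<in> {1..N}"
    show "posdef_cost (ar n)" using H_posdef area unfolding posdef_cost_def quad_form_def by blast
    show "prob_space (F n)" using F_prob area by blast
    show "D n (Suc t) \<in> borel_measurable M"
      using iid area by (auto simp: prob_space.indep_vars_def[OF M_prob])
    show "distr M borel (D n (Suc t)) = F n" using iid area by simp
    fix q assume "q \<in> Pi {1..I} (\<lambda>i. {..Q i})"
    then have q_within: "\<forall>i\<in>{1..I}. q i \<le> Q i" by auto
    show "AE d in F n. nondegenerate (ar n) I (qloc I orig dest q n) d"
      using feas_nondeg[rule_format, OF area, of q] q_within by auto
    show "integrable (F n) (opt_cost (ar n) I (qloc I orig dest q n))"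
      using Cbar_finite area q_within unfolding opt_cost_def[abs_def] by blast
  qed (use interfaces init update[rule_format, of "Suc _"] in \<open>auto simp: opt_cost_def\<close>)
  obtain \<sigma> :: "nat \<Rightarrow> nat" where "strict_mono \<sigma>" "converges_on {1..I} (\<lambda>k. qs (\<sigma> k)) qt"
    using limit_point unfolding converges_on_def by blast
  note optimal = schedule_limit_point_optimal[OF this]
  show ?thesis using optimal(1)[OF schedule_init] optimal(2) by (auto simp: Pi_iff)
qed

end
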